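(* Let $\Psi\in\mathbb R[c_1,\dots,c_m]_n$ be a homogeneous polynomial of degree $n$. Then $\Psi$ is the volume polynomial $V_\Delta$ of some complete simplicial multi-fan $\Delta$ (in an $n$-dimensional oriented Euclidean space, on the vertex set $[m]$) if and only if (1) $\dim\mathrm{Ann}^2\Psi\ge n$, and (2) $\partial_I\Psi=0$ for every $I\in\mathrm{dep}(\mathrm{Ann}^2\Psi)$.
   Context: $\partial_i=\partial/\partial c_i$ and $\partial_I=\prod_{i\in I}\partial_i$. $\mathrm{Ann}^2\Psi=\{D\in\langle\partial_1,\dots,\partial_m\rangle: D\Psi=0\}$, a subspace of the space $(\mathbb R^m)^*=\langle\partial_1,\dots,\partial_m\rangle$ of linear differential operators. For $I\subset[m]$ let $\alpha_I^*\colon(\mathbb R^m)^*\to(\mathbb R^I)^*$ be the projection $\sum_ia_i\partial_i\mapsto(a_i)_{i\in I}$. For a subspace $\Pi\subset(\mathbb R^m)^*$, $\mathrm{dep}(\Pi)=\{I\subset[m]: |I|\le n\text{ and }\alpha_I^*|_\Pi\colon\Pi\to(\mathbb R^I)^*\text{ is not surjective}\}$. Multi-fans: let $V$ be an oriented real $n$-dimensional vector space with inner product ($V^*=V$). A complete simplicial multi-fan $\Delta=(w,\lambda)$ on $[m]$: $w\colon\binom{[m]}n\to\mathbb R$, $\lambda\colon[m]\to V$, with $\{\lambda(i)\}_{i\in I}$ a basis whenever $w(I)\ne0$, and (orienting such $I$ so that $(i_1,\dots,i_n)$ is positive iff $(\lambda(i_1),\dots,\lambda(i_n))$ is a positive basis)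 $\sum_Iw(I)I$ is a cycle in the real chain complex of the $(n-1)$-skeleton of the simplex on $[m]$ (augmentation if $n=1$). Volume polynomial: with $\deg x_i=2$, for $w(I)\ne0$ let $\{u^I_i\}$ be the dual basis to $\{\lambda(i)\}_{i\in I}$, $\iota_I(x_i)=u^I_i$ for $i\in I$, $0$ otherwise, and $|\det\lambda_I|$ the volume of the parallelepiped; for $x$ of degree $2n$, $\int_\Delta x=\sum_I\frac{w(I)\iota_I(x)}{|\det\lambda_I|\prod_{i\in I}\iota_I(x_i)}$ is a constant, and $V_\Delta(c)=\frac1{n!}\int_\Delta(c_1x_1+\dots+c_mx_m)^n$.
   Formalization: It is assumed that n ≥ 1 and that n ≤ m or Ψ ≠ 0: if m < n and Ψ = 0, the empty multi-fan has volume polynomial 0 = Ψ, but dim Ann²Ψ = m < n, so the stated equivalence fails in exactly that case. *)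

theory Defs
  imports
    "HOL-Analysis.Analysis"
    "HOL-Analysis.Finite_Function_Topology"
    "HOL-Library.Poly_Mapping"
    "HOL-Library.Ramsey"
    "Jordan_Normal_Form.Determinant"
begin

section \<open>Polynomials and differential operators\<close>

text \<open>
  A monomial is its exponent vector, a polynomial maps exponent vectors to coefficients.
  The variable with index \<open>i\<close> is \<open>single (single i 1) 1\<close>.
\<close>

type_synonym rpoly = "(nat \<Rightarrow>\<^sub>0 nat) \<Rightarrow>\<^sub>0 real"

definition poly_eval :: "(nat \<Rightarrow> real) \<Rightarrow> rpoly \<Rightarrow> real" where
  "poly_eval a p = (\<Sum>\<alpha>\<in>Poly_Mapping.keys p.
     Poly_Mapping.lookup p \<alpha> *
       (\<Prod>i\<in>Poly_Mapping.keys \<alpha>. a i ^ Poly_Mapping.lookup \<alpha> i))"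

text \<open>The space \<open>\<real>[c\<^sub>1, \<dots>, c\<^sub>m]\<^sub>n\<close>; the zero polynomial belongs to it.\<close>

definition homogeneous_polys :: "nat \<Rightarrow> nat \<Rightarrow> rpoly set" where
  "homogeneous_polys m n = {p. \<forall>\<alpha>\<in>Poly_Mapping.keys p.
     Poly_Mapping.keys \<alpha> \<subseteq> {1..m} \<and>
     (\<Sum>i\<in>Poly_Mapping.keys \<alpha>. Poly_Mapping.lookup \<alpha> i) = n}"

definition partial_deriv :: "nat \<Rightarrow> rpoly \<Rightarrow> rpoly" where
  "partial_deriv i p = (\<Sum>\<alpha>\<in>Poly_Mapping.keys p.
     Poly_Mapping.single (\<alpha> - Poly_Mapping.single i 1)
       (real (Poly_Mapping.lookup \<alpha> i) * Poly_Mapping.lookup p \<alpha>))"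

text \<open>
  The partial derivatives commute, so that the increasing order used here is immaterial.
\<close>

definition partial_deriv_set :: "nat set \<Rightarrow> rpoly \<Rightarrow> rpoly" where
  "partial_deriv_set I p = foldr partial_deriv (sorted_list_of_set I) p"

text \<open>
  For \<open>I \<subseteq> [m]\<close>, elements of \<open>(\<real>\<^sup>I)\<^sup>*\<close> are coefficient vectors supported in \<open>I\<close>.
  The vector \<open>a\<close> in \<open>coeff_space {1..m}\<close> stands for the operator
  \<open>a\<^sub>1 \<partial>\<^sub>1 + \<dots> + a\<^sub>m \<partial>\<^sub>m\<close>.
\<close>

definition coeff_space :: "nat set \<Rightarrow> (nat \<Rightarrow>\<^sub>0 real) set" where
  "coeff_space I = {a. Poly_Mapping.keys a \<subseteq> I}"

definition linear_diff_op :: "nat \<Rightarrow> (nat \<Rightarrow>\<^sub>0 real) \<Rightarrow> rpoly \<Rightarrow> rpoly" where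
  "linear_diff_op m a p = (\<Sum>i\<in>{1..m}. Poly_Mapping.lookup a i *\<^sub>R partial_deriv i p)"

definition Ann2 :: "nat \<Rightarrow> rpoly \<Rightarrow> (nat \<Rightarrow>\<^sub>0 real) set" where
  "Ann2 m p = {a \<in> coeff_space {1..m}. linear_diff_op m a p = 0}"

definition coord_proj :: "nat set \<Rightarrow> (nat \<Rightarrow>\<^sub>0 real) \<Rightarrow> (nat \<Rightarrow>\<^sub>0 real)" where
  "coord_proj I a = (\<Sum>i\<in>I. Poly_Mapping.single i (Poly_Mapping.lookup a i))"

definition dep :: "nat \<Rightarrow> nat \<Rightarrow> (nat \<Rightarrow>\<^sub>0 real) set \<Rightarrow> nat set set" where
  "dep m n P = {I. I \<subseteq> {1..m} \<and> card I \<le> n \<and> coord_proj I ` P \<noteq> coeff_space I}"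


section \<open>Complete simplicial multi-fans\<close>

text \<open>
  The oriented Euclidean space \<open>V\<close> is a type of class \<^class>\<open>euclidean_space\<close> whose orientation
  is given by a positive orthonormal basis \<open>e\<close>. The determinant of a list of vectors is taken in
  the coordinates of \<open>e\<close>: its sign compares the list with the orientation, and its absolute value
  is the volume of the parallelepiped spanned by the list.
\<close>

definition orthonormal_frame :: "'v::euclidean_space list \<Rightarrow> bool" where
  "orthonormal_frame e \<longleftrightarrow> length e = DIM('v) \<and>
     (\<forall>j<DIM('v). \<forall>k<DIM('v). inner (e ! j) (e ! k) = (if j = k then 1 else 0))"

definition frame_det :: "'v::euclidean_space list \<Rightarrow> 'v list \<Rightarrow> real" where
  "frame_det e vs =
     Determinant.det (Matrix.mat DIM('v) DIM('v) (\<lambda>(j, k). inner (e ! j) (vs ! k)))"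

text \<open>\<open>det \<lambda>\<^sub>I\<close>, with the vertices of \<open>I\<close> taken in increasing order.\<close>

definition face_det :: "'v::euclidean_space list \<Rightarrow> (nat \<Rightarrow> 'v) \<Rightarrow> nat set \<Rightarrow> real" where
  "face_det e lam I = frame_det e (map lam (sorted_list_of_set I))"

definition basis_on :: "(nat \<Rightarrow> 'v::euclidean_space) \<Rightarrow> nat set \<Rightarrow> bool" where
  "basis_on lam I \<longleftrightarrow> inj_on lam I \<and> independent (lam ` I) \<and> span (lam ` I) = UNIV"

text \<open>
  Simplicial chains in the simplex on \<open>[m]\<close>: \<open>c I\<close> is the coefficient of the simplex \<open>I\<close> with its
  vertices in increasing order. The coefficient of \<open>J\<close> in the boundary of \<open>J \<union> {i}\<close> is
  \<open>(-1)\<^sup>k\<close>, where \<open>k\<close> is the number of vertices of \<open>J\<close> preceding \<open>i\<close>. The empty simplex is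
  allowed for \<open>J\<close>, which gives the augmentation on the chains of dimension zero.
\<close>

definition chain_boundary :: "nat \<Rightarrow> (nat set \<Rightarrow> real) \<Rightarrow> nat set \<Rightarrow> real" where
  "chain_boundary m c J = (\<Sum>i\<in>{1..m} - J. (-1) ^ card {j\<in>J. j < i} * c (insert i J))"

text \<open>
  The chain \<open>\<Sum>\<^sub>I w(I) I\<close>. Each \<open>I\<close> with \<open>w(I) \<noteq> 0\<close> is oriented by \<open>\<lambda>\<close>, hence equals \<open>sgn (det \<lambda>\<^sub>I)\<close>
  times the simplex \<open>I\<close> in increasing order.
\<close>

definition multifan_chain ::
  "'v::euclidean_space list \<Rightarrow> (nat set \<Rightarrow> real) \<Rightarrow> (nat \<Rightarrow> 'v) \<Rightarrow> nat set \<Rightarrow> real" where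
  "multifan_chain e w lam I = w I * sgn (face_det e lam I)"

text \<open>
  Only the values of \<open>w\<close> on the \<open>n\<close>-element subsets of \<open>[m]\<close> and those of \<open>\<lambda>\<close> on \<open>[m]\<close> matter,
  where \<open>n = DIM('v)\<close>. By definition \<^term>\<open>nsets A k\<close> is the set of \<open>k\<close>-element subsets of \<open>A\<close>.
\<close>

definition complete_multifan ::
  "'v::euclidean_space list \<Rightarrow> nat \<Rightarrow> (nat set \<Rightarrow> real) \<Rightarrow> (nat \<Rightarrow> 'v) \<Rightarrow> bool" where
  "complete_multifan e m w lam \<longleftrightarrow>
     (\<forall>I\<in>nsets {1..m} DIM('v). w I \<noteq> 0 \<longrightarrow> basis_on lam I) \<and>
     (\<forall>J\<in>nsets {1..m} (DIM('v) - 1). chain_boundary m (multifan_chain e w lam) J = 0)"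


section \<open>Volume polynomial\<close>

definition support_faces ::
  "'v::euclidean_space itself \<Rightarrow> nat \<Rightarrow> (nat set \<Rightarrow> real) \<Rightarrow> nat set set" where
  "support_faces _ m w = {I \<in> nsets {1..m} DIM('v). w I \<noteq> 0}"

text \<open>
  \<open>dual_basis \<lambda> I i\<close> is \<open>u\<^sup>I\<^sub>i\<close> for \<open>i \<in> I\<close>, under the identification \<open>V\<^sup>* = V\<close>; the values outside \<open>I\<close>
  are set to zero.
\<close>

definition dual_basis :: "(nat \<Rightarrow> 'v::euclidean_space) \<Rightarrow> nat set \<Rightarrow> nat \<Rightarrow> 'v" where
  "dual_basis lam I = (THE u.
     (\<forall>i\<in>I. \<forall>j\<in>I. inner (u i) (lam j) = (if i = j then 1 else 0)) \<and> (\<forall>i. i \<notin> I \<longrightarrow> u i = 0))"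

text \<open>
  The ring homomorphism \<open>\<iota>\<^sub>I\<close> takes values in the algebra of polynomial functions on \<open>V\<close>, a vector
  \<open>u \<in> V = V\<^sup>*\<close> being the function \<open>v \<mapsto> \<langle>u, v\<rangle>\<close>. Here \<open>iota \<lambda> I x v\<close> is the value of
  \<open>\<iota>\<^sub>I(x)\<close> at \<open>v\<close>, and the index variable \<open>x\<^sub>i\<close> is sent to \<open>u\<^sup>I\<^sub>i\<close> or to zero.
\<close>

definition iota :: "(nat \<Rightarrow> 'v::euclidean_space) \<Rightarrow> nat set \<Rightarrow> rpoly \<Rightarrow> 'v \<Rightarrow> real" where
  "iota lam I x v = poly_eval (\<lambda>i. if i \<in> I then inner (dual_basis lam I i) v else 0) x"

definition poly_var :: "nat \<Rightarrow> rpoly" where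
  "poly_var i = Poly_Mapping.single (Poly_Mapping.single i 1) 1"

text \<open>
  The rational function \<open>\<Sum>\<^sub>I w(I) \<iota>\<^sub>I(x) / (\<bar>det \<lambda>\<^sub>I\<bar> \<Prod>\<^sub>i \<iota>\<^sub>I(x\<^sub>i))\<close> on \<open>V\<close>. Its values have a meaning
  at the vectors where no denominator vanishes; \<open>\<integral>\<^sub>\<Delta> x\<close> is the constant value there.
\<close>

definition generic_vectors ::
  "nat \<Rightarrow> (nat set \<Rightarrow> real) \<Rightarrow> (nat \<Rightarrow> 'v::euclidean_space) \<Rightarrow> 'v set" where
  "generic_vectors m w lam =
     {v. \<forall>I\<in>support_faces TYPE('v) m w. \<forall>i\<in>I. iota lam I (poly_var i) v \<noteq> 0}"

definition multifan_integrand ::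
  "'v::euclidean_space list \<Rightarrow> nat \<Rightarrow> (nat set \<Rightarrow> real) \<Rightarrow> (nat \<Rightarrow> 'v) \<Rightarrow> rpoly \<Rightarrow> 'v \<Rightarrow> real" where
  "multifan_integrand e m w lam x v = (\<Sum>I\<in>support_faces TYPE('v) m w.
     w I * iota lam I x v / (\<bar>face_det e lam I\<bar> * (\<Prod>i\<in>I. iota lam I (poly_var i) v)))"

definition multifan_integral ::
  "'v::euclidean_space list \<Rightarrow> nat \<Rightarrow> (nat set \<Rightarrow> real) \<Rightarrow> (nat \<Rightarrow> 'v) \<Rightarrow> rpoly \<Rightarrow> real" where
  "multifan_integral e m w lam x =
     (THE a. \<forall>v\<in>generic_vectors m w lam. multifan_integrand e m w lam x v = a)"

text \<open>\<open>V\<^sub>\<Delta>\<close> as a polynomial function of \<open>c = (c\<^sub>1, \<dots>, c\<^sub>m)\<close>.\<close>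

definition volume_polynomial ::
  "'v::euclidean_space list \<Rightarrow> nat \<Rightarrow> (nat set \<Rightarrow> real) \<Rightarrow> (nat \<Rightarrow> 'v) \<Rightarrow> (nat \<Rightarrow> real) \<Rightarrow> real" where
  "volume_polynomial e m w lam c =
     1 / fact DIM('v) *
       multifan_integral e m w lam ((\<Sum>i\<in>{1..m}. c i *\<^sub>R poly_var i) ^ DIM('v))"

end

theory Submission
  imports Defs
begin

text \<open>
  The volume polynomial of a multi-fan is studied through the moments of \<open>x\<^sup>\<alpha>\<close>, the values at a generic
  vector \<open>v\<close> of the rational function defining \<open>\<integral>\<^sub>\<Delta> x\<^sup>\<alpha>\<close>. For every \<open>u\<close> they satisfy
  \<open>\<Sum>\<^sub>i \<langle>u, \<lambda>\<^sub>i\<rangle> R(x\<^sub>i x\<^sup>\<beta>) = \<langle>u, v\<rangle> R(x\<^sup>\<beta>)\<close>, and they vanish if the vectors \<open>\<lambda>\<^sub>i\<close>, \<open>i \<in> supp \<alpha>\<close>, are dependent.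
  If these vectors are independent, choosing \<open>u\<close> dual to \<open>\<lambda>\<^sub>i\<close> for a repeated index \<open>i\<close> trades one factor \<open>x\<^sub>i\<close> for
  new variables, so that everything reduces to squarefree monomials. In degree \<open>n - 1\<close> those vanish by the
  cycle condition, in degree \<open>n\<close> they equal \<open>w(I) / \<bar>det \<lambda>\<^sub>I\<bar>\<close>. Hence the integral is well defined, the operators
  \<open>\<Sum>\<^sub>i \<langle>u, \<lambda>\<^sub>i\<rangle> \<partial>\<^sub>i\<close> annihilate \<open>V\<^sub>\<Delta>\<close>, and \<open>\<partial>\<^sub>I V\<^sub>\<Delta> = 0\<close> whenever \<open>\<lambda>\<^sub>I\<close> is dependent.

  Conversely, \<open>n\<close> generic elements of \<open>Ann\<^sup>2 \<Psi>\<close> are the coordinates of vectors \<open>\<lambda>\<^sub>i\<close> for which \<open>\<lambda>\<^sub>I\<close> is dependent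
  only if \<open>I \<in> dep(Ann\<^sup>2 \<Psi>)\<close>. Put \<open>w(I) = \<bar>det \<lambda>\<^sub>I\<bar> \<partial>\<^sub>I \<Psi>\<close>. The boundary coefficient at \<open>J\<close> is \<open>\<partial>\<^sub>J\<close> of an annihilating
  operator applied to \<open>\<Psi>\<close>, so the cycle condition holds. By the same reduction the derivatives of \<open>\<Psi>\<close> of order \<open>n\<close>
  are the moments of degree \<open>n\<close>, and Euler's identity gives \<open>\<Psi> = V\<^sub>\<Delta>\<close>.
\<close>

section \<open>Polynomials\<close>

definition monom_eval :: "(nat \<Rightarrow> real) \<Rightarrow> (nat \<Rightarrow>\<^sub>0 nat) \<Rightarrow> real" where
  "monom_eval a \<alpha> = (\<Prod>i\<in>Poly_Mapping.keys \<alpha>. a i ^ Poly_Mapping.lookup \<alpha> i)"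

lemma monom_eval_superset:
  assumes "finite K" "Poly_Mapping.keys \<alpha> \<subseteq> K"
  shows "monom_eval a \<alpha> = (\<Prod>i\<in>K. a i ^ Poly_Mapping.lookup \<alpha> i)"
  unfolding monom_eval_def
  by (rule prod.mono_neutral_left) (use assms in \<open>auto simp: in_keys_iff\<close>)

lemma monom_eval_0 [simp]: "monom_eval a 0 = 1"
  by (simp add: monom_eval_def)

lemma monom_eval_single [simp]: "monom_eval a (Poly_Mapping.single i k) = a i ^ k"
  by (simp add: monom_eval_def)

lemma monom_eval_add: "monom_eval a (\<alpha> + \<beta>) = monom_eval a \<alpha> * monom_eval a \<beta>"
proof -
  let ?K = "Poly_Mapping.keys \<alpha> \<union> Poly_Mapping.keys \<beta>"
  have "monom_eval a (\<alpha> + \<beta>) = (\<Prod>i\<in>?K. a i ^ Poly_Mapping.lookup (\<alpha> + \<beta>) i)"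
    by (rule monom_eval_superset) (use keys_add[of \<alpha> \<beta>] in auto)
  also have "\<dots> = monom_eval a \<alpha> * monom_eval a \<beta>"
    by (simp add: monom_eval_superset[of ?K] lookup_add power_add prod.distrib)
  finally show ?thesis .
qed

lemma poly_eval_superset:
  assumes "finite K" "Poly_Mapping.keys p \<subseteq> K"
  shows "poly_eval a p = (\<Sum>\<alpha>\<in>K. Poly_Mapping.lookup p \<alpha> * monom_eval a \<alpha>)"
  unfolding poly_eval_def monom_eval_def
  by (rule sum.mono_neutral_left) (use assms in \<open>auto simp: in_keys_iff\<close>)

lemma poly_eval_zero [simp]: "poly_eval a 0 = 0"
  by (simp add: poly_eval_def)

lemma poly_eval_single [simp]: "poly_eval a (Poly_Mapping.single \<alpha> k) = k * monom_eval a \<alpha>"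
  by (simp add: poly_eval_superset[of "{\<alpha>}"])

lemma poly_eval_add: "poly_eval a (p + q) = poly_eval a p + poly_eval a q"
proof -
  let ?K = "Poly_Mapping.keys p \<union> Poly_Mapping.keys q"
  have "poly_eval a (p + q) = (\<Sum>\<alpha>\<in>?K. Poly_Mapping.lookup (p + q) \<alpha> * monom_eval a \<alpha>)"
    by (rule poly_eval_superset) (use keys_add[of p q] in auto)
  also have "\<dots> = poly_eval a p + poly_eval a q"
    by (simp add: poly_eval_superset[of ?K] lookup_add ring_distribs sum.distrib)
  finally show ?thesis .
qed

lemma poly_eval_sum: "poly_eval a (sum f A) = (\<Sum>x\<in>A. poly_eval a (f x))"
  by (induction A rule: infinite_finite_induct) (simp_all add: poly_eval_add)

lemma lookup_scaleR [simp]: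
  "Poly_Mapping.lookup (r *\<^sub>R p) k = r *\<^sub>R Poly_Mapping.lookup p k"
proof -
  have "finite {k. r *\<^sub>R Poly_Mapping.lookup p k \<noteq> 0}"
    by (rule finite_subset[of _ "Poly_Mapping.keys p"]) (auto simp: in_keys_iff)
  then show ?thesis
    by (simp add: scaleR_poly_mapping_def)
qed

lemma poly_eval_scaleR: "poly_eval a (r *\<^sub>R p) = r * poly_eval a p"
proof -
  have "Poly_Mapping.keys (r *\<^sub>R p) \<subseteq> Poly_Mapping.keys p"
    by (auto simp: in_keys_iff)
  then show ?thesis
    by (simp add: poly_eval_superset[of "Poly_Mapping.keys p"] sum_distrib_left mult.assoc)
qed

lemma poly_mapping_eq_sum_single:
  "p = (\<Sum>\<alpha>\<in>Poly_Mapping.keys p. Poly_Mapping.single \<alpha> (Poly_Mapping.lookup p \<alpha>))"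
  by (rule poly_mapping_eqI) (simp add: lookup_sum lookup_single when_def in_keys_iff)

lemma poly_eval_mult: "poly_eval a (p * q) = poly_eval a p * poly_eval a q"
proof -
  have "p * q = (\<Sum>\<alpha>\<in>Poly_Mapping.keys p. \<Sum>\<beta>\<in>Poly_Mapping.keys q.
      Poly_Mapping.single (\<alpha> + \<beta>) (Poly_Mapping.lookup p \<alpha> * Poly_Mapping.lookup q \<beta>))"
    by (subst (1) poly_mapping_eq_sum_single[of p], subst (1) poly_mapping_eq_sum_single[of q])
       (simp add: sum_product mult_single)
  then have "poly_eval a (p * q) = (\<Sum>\<alpha>\<in>Poly_Mapping.keys p. \<Sum>\<beta>\<in>Poly_Mapping.keys q.
      (Poly_Mapping.lookup p \<alpha> * monom_eval a \<alpha>) * (Poly_Mapping.lookup q \<beta> * monom_eval a \<beta>))"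
    by (simp add: poly_eval_sum monom_eval_add mult_ac)
  also have "\<dots> = poly_eval a p * poly_eval a q"
    by (simp add: sum_product poly_eval_superset[of "Poly_Mapping.keys p"]
        poly_eval_superset[of "Poly_Mapping.keys q"])
  finally show ?thesis .
qed

lemma poly_eval_power: "poly_eval a (p ^ k) = poly_eval a p ^ k"
proof (induction k)
  case 0
  have "poly_eval a 1 = 1"
    unfolding single_one[symmetric] by (subst poly_eval_single) simp
  then show ?case by simp
qed (simp add: poly_eval_mult)

lemma poly_eval_var [simp]: "poly_eval a (poly_var i) = a i"
  by (simp add: poly_var_def)

section \<open>Formal partial derivatives and derivatives of the evaluation\<close>

lemma lookup_partial_deriv:
  "Poly_Mapping.lookup (partial_deriv i p) \<beta> =
     real (Poly_Mapping.lookup \<beta> i + 1) * Poly_Mapping.lookup p (\<beta> + Poly_Mapping.single i 1)"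
proof -
  let ?e = "Poly_Mapping.single i (1::nat)"
  \<comment> \<open>Subtraction of exponents is truncated, so a monomial free of the variable
    \<open>i\<close> is sent to its own exponent vector, but with coefficient 0. Only the shifted
    monomial contributes at \<beta>.\<close>
  have shift: "\<alpha> = \<beta> + ?e" if "\<alpha> - ?e = \<beta>" "Poly_Mapping.lookup \<alpha> i \<noteq> 0" for \<alpha>
  proof (rule poly_mapping_eqI)
    fix k
    show "Poly_Mapping.lookup \<alpha> k = Poly_Mapping.lookup (\<beta> + ?e) k"
      using that by (auto simp: lookup_add lookup_minus lookup_single when_def)
  qed
  have "Poly_Mapping.lookup (partial_deriv i p) \<beta> = (\<Sum>\<alpha>\<in>Poly_Mapping.keys p.
      (real (Poly_Mapping.lookup \<alpha> i) * Poly_Mapping.lookup p \<alpha> when \<alpha> - ?e = \<beta>))"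
    by (simp add: partial_deriv_def lookup_sum lookup_single)
  also have "\<dots> = (\<Sum>\<alpha>\<in>Poly_Mapping.keys p.
      if \<alpha> = \<beta> + ?e then real (Poly_Mapping.lookup \<alpha> i) * Poly_Mapping.lookup p \<alpha> else 0)"
    by (rule sum.cong) (use shift in \<open>auto simp: when_def\<close>)
  also have "\<dots> = real (Poly_Mapping.lookup \<beta> i + 1) * Poly_Mapping.lookup p (\<beta> + ?e)"
    by (simp add: sum.delta in_keys_iff lookup_add)
  finally show ?thesis .
qed

lemma partial_deriv_commute:
  "partial_deriv i (partial_deriv j p) = partial_deriv j (partial_deriv i p)"
  by (rule poly_mapping_eqI)
     (auto simp: lookup_partial_deriv lookup_add lookup_single when_def add.commute add.left_commute)

lemma partial_deriv_add: "partial_deriv i (p + q) = partial_deriv i p + partial_deriv i q"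
  by (rule poly_mapping_eqI) (simp add: lookup_partial_deriv lookup_add algebra_simps)

lemma partial_deriv_scaleR: "partial_deriv i (r *\<^sub>R p) = r *\<^sub>R partial_deriv i p"
  by (rule poly_mapping_eqI) (simp add: lookup_partial_deriv)

lemma partial_deriv_zero [simp]: "partial_deriv i 0 = 0"
  by (simp add: partial_deriv_def)

lemma partial_deriv_sum: "partial_deriv i (sum f A) = (\<Sum>x\<in>A. partial_deriv i (f x))"
  by (induction A rule: infinite_finite_induct) (simp_all add: partial_deriv_add)

lemma poly_eval_partial_deriv:
  "poly_eval a (partial_deriv i p) = (\<Sum>\<alpha>\<in>Poly_Mapping.keys p.
     Poly_Mapping.lookup p \<alpha> * (real (Poly_Mapping.lookup \<alpha> i) *
       monom_eval a (\<alpha> - Poly_Mapping.single i 1)))"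
  by (simp add: partial_deriv_def poly_eval_sum mult_ac)

lemma monom_eval_split:
  "monom_eval a \<alpha> = a i ^ Poly_Mapping.lookup \<alpha> i *
     monom_eval a (\<alpha> - Poly_Mapping.single i (Poly_Mapping.lookup \<alpha> i))"
proof -
  have "\<alpha> = Poly_Mapping.single i (Poly_Mapping.lookup \<alpha> i) +
      (\<alpha> - Poly_Mapping.single i (Poly_Mapping.lookup \<alpha> i))"
    by (rule poly_mapping_eqI) (auto simp: lookup_add lookup_minus lookup_single when_def)
  then show ?thesis
    by (metis monom_eval_add monom_eval_single)
qed

lemma monom_eval_fun_upd:
  assumes "Poly_Mapping.lookup \<alpha> i = 0"
  shows "monom_eval (a(i := t)) \<alpha> = monom_eval a \<alpha>"
  unfolding monom_eval_def by (rule prod.cong) (use assms in \<open>auto simp: in_keys_iff\<close>)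

text \<open>Splitting off the power of the variable \<open>i\<close> leaves the power rule in one
  variable. If the exponent is 0, the truncated subtraction does no harm because the factor in front
  vanishes.\<close>

lemma monom_eval_DERIV:
  "((\<lambda>t. monom_eval (a(i := t)) \<alpha>) has_field_derivative
     real (Poly_Mapping.lookup \<alpha> i) * monom_eval (a(i := t)) (\<alpha> - Poly_Mapping.single i 1)) (at t)"
proof -
  let ?k = "Poly_Mapping.lookup \<alpha> i"
  let ?\<beta> = "\<alpha> - Poly_Mapping.single i ?k"
  have 1: "monom_eval (a(i := t)) \<alpha> = t ^ ?k * monom_eval a ?\<beta>" for t
    by (subst monom_eval_split[of _ _ i], subst monom_eval_fun_upd) (simp_all add: lookup_minus)
  have 2: "real ?k * monom_eval (a(i := t)) (\<alpha> - Poly_Mapping.single i 1) =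
      real ?k * (t ^ (?k - 1) * monom_eval a ?\<beta>)"
  proof (cases "?k = 0")
    case False
    have "\<alpha> - Poly_Mapping.single i 1 - Poly_Mapping.single i (?k - 1) = ?\<beta>"
      by (rule poly_mapping_eqI) (use False in \<open>auto simp: lookup_minus lookup_single when_def\<close>)
    moreover have "Poly_Mapping.lookup (\<alpha> - Poly_Mapping.single i 1) i = ?k - 1"
      by (simp add: lookup_minus)
    ultimately have "monom_eval (a(i := t)) (\<alpha> - Poly_Mapping.single i 1) =
        t ^ (?k - 1) * monom_eval (a(i := t)) ?\<beta>"
      by (subst monom_eval_split[of _ _ i]) simp
    then show ?thesis
      by (simp add: monom_eval_fun_upd lookup_minus)
  qed simp
  show ?thesis
    unfolding 1 2 by (auto intro!: derivative_eq_intros)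
qed

lemma poly_eval_DERIV:
  "((\<lambda>t. poly_eval (a(i := t)) p) has_field_derivative
     poly_eval (a(i := t)) (partial_deriv i p)) (at t)"
  unfolding poly_eval_partial_deriv poly_eval_superset[OF finite_keys subset_refl[of "Poly_Mapping.keys p"]]
  by (intro DERIV_sum DERIV_cmult monom_eval_DERIV)

section \<open>Homogeneous polynomials\<close>

lemma homogeneous_polys_iff:
  "p \<in> homogeneous_polys m k \<longleftrightarrow> (\<forall>\<alpha>\<in>Poly_Mapping.keys p.
     Poly_Mapping.keys \<alpha> \<subseteq> {1..m} \<and> (\<Sum>i\<in>{1..m}. Poly_Mapping.lookup \<alpha> i) = k)"
proof -
  have "(\<Sum>i\<in>Poly_Mapping.keys \<alpha>. Poly_Mapping.lookup \<alpha> i) = (\<Sum>i\<in>{1..m}. Poly_Mapping.lookup \<alpha> i)"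
    if "Poly_Mapping.keys \<alpha> \<subseteq> {1..m}" for \<alpha> :: "nat \<Rightarrow>\<^sub>0 nat"
    by (rule sum.mono_neutral_left) (use that in \<open>auto simp: in_keys_iff\<close>)
  then show ?thesis
    unfolding homogeneous_polys_def by auto
qed

lemma zero_homogeneous: "0 \<in> homogeneous_polys m k"
  by (simp add: homogeneous_polys_iff)

lemma add_homogeneous:
  "p \<in> homogeneous_polys m k \<Longrightarrow> q \<in> homogeneous_polys m k \<Longrightarrow> p + q \<in> homogeneous_polys m k"
  unfolding homogeneous_polys_def using keys_add[of p q] by blast

lemma scaleR_homogeneous:
  "p \<in> homogeneous_polys m k \<Longrightarrow> r *\<^sub>R p \<in> homogeneous_polys m k"
  unfolding homogeneous_polys_def by (auto simp: in_keys_iff)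

lemma sum_homogeneous:
  "(\<And>x. x \<in> A \<Longrightarrow> f x \<in> homogeneous_polys m k) \<Longrightarrow> sum f A \<in> homogeneous_polys m k"
  by (induction A rule: infinite_finite_induct) (auto simp: zero_homogeneous add_homogeneous)

lemma partial_deriv_homogeneous:
  assumes "p \<in> homogeneous_polys m k"
  shows "partial_deriv i p \<in> homogeneous_polys m (k - 1)"
  unfolding homogeneous_polys_iff
proof
  fix \<alpha> assume "\<alpha> \<in> Poly_Mapping.keys (partial_deriv i p)"
  then have "\<alpha> + Poly_Mapping.single i 1 \<in> Poly_Mapping.keys p"
    by (auto simp: in_keys_iff lookup_partial_deriv)
  then have *: "Poly_Mapping.keys (\<alpha> + Poly_Mapping.single i 1) \<subseteq> {1..m}"
      "(\<Sum>j\<in>{1..m}. Poly_Mapping.lookup (\<alpha> + Poly_Mapping.single i 1) j) = k"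
    using assms unfolding homogeneous_polys_iff by blast+
  have i: "i \<in> {1..m}" and "Poly_Mapping.keys \<alpha> \<subseteq> {1..m}"
    using *(1) by (auto simp: in_keys_iff lookup_add lookup_single when_def subset_iff)
  moreover have "(\<Sum>j\<in>{1..m}. Poly_Mapping.lookup \<alpha> j) + 1 = k"
    using *(2) i by (simp add: lookup_add sum.distrib lookup_single when_def)
  ultimately show "Poly_Mapping.keys \<alpha> \<subseteq> {1..m} \<and> (\<Sum>j\<in>{1..m}. Poly_Mapping.lookup \<alpha> j) = k - 1"
    by auto
qed

text \<open>Multiplying by \<open>c i\<close> after differentiating in \<open>i\<close> scales each
  monomial by its exponent at \<open>i\<close>, and these exponents add up to
  \<open>k\<close>.\<close>

lemma euler_identity:
  assumes "p \<in> homogeneous_polys m k"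
  shows "(\<Sum>i\<in>{1..m}. c i * poly_eval c (partial_deriv i p)) = real k * poly_eval c p"
proof -
  have mono: "c i * (real (Poly_Mapping.lookup \<alpha> i) * monom_eval c (\<alpha> - Poly_Mapping.single i 1)) =
      real (Poly_Mapping.lookup \<alpha> i) * monom_eval c \<alpha>" for i \<alpha>
  proof (cases "Poly_Mapping.lookup \<alpha> i = 0")
    case False
    then have "Poly_Mapping.single i 1 + (\<alpha> - Poly_Mapping.single i 1) = \<alpha>"
      by (intro poly_mapping_eqI) (auto simp: lookup_add lookup_minus lookup_single when_def)
    then have "monom_eval c \<alpha> = c i * monom_eval c (\<alpha> - Poly_Mapping.single i 1)"
      by (metis monom_eval_add monom_eval_single power_one_right)
    then show ?thesis by simp
  qed simp
  have "(\<Sum>i\<in>{1..m}. c i * poly_eval c (partial_deriv i p)) =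
      (\<Sum>i\<in>{1..m}. \<Sum>\<alpha>\<in>Poly_Mapping.keys p. Poly_Mapping.lookup p \<alpha> *
        (c i * (real (Poly_Mapping.lookup \<alpha> i) * monom_eval c (\<alpha> - Poly_Mapping.single i 1))))"
    by (simp add: poly_eval_partial_deriv sum_distrib_left mult_ac)
  also have "\<dots> = (\<Sum>\<alpha>\<in>Poly_Mapping.keys p. Poly_Mapping.lookup p \<alpha> * (monom_eval c \<alpha> *
      real (\<Sum>i\<in>{1..m}. Poly_Mapping.lookup \<alpha> i)))"
    unfolding mono by (subst sum.swap) (simp add: sum_distrib_left mult_ac)
  also have "\<dots> = (\<Sum>\<alpha>\<in>Poly_Mapping.keys p. Poly_Mapping.lookup p \<alpha> * (monom_eval c \<alpha> * real k))"
    by (rule sum.cong) (use assms in \<open>auto simp: homogeneous_polys_iff\<close>)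
  also have "\<dots> = real k * poly_eval c p"
    by (simp add: poly_eval_superset[OF finite_keys subset_refl] sum_distrib_left mult_ac)
  finally show ?thesis .
qed

text \<open>Differentiating lowers the degree until only a constant is left.\<close>

lemma homogeneous_eq_0:
  assumes "p \<in> homogeneous_polys m k" "\<And>c. poly_eval c p = 0"
  shows "p = 0"
  using assms
proof (induction k arbitrary: p)
  case 0
  have "Poly_Mapping.keys p \<subseteq> {0}"
  proof
    fix \<alpha> assume \<alpha>: "\<alpha> \<in> Poly_Mapping.keys p"
    have "Poly_Mapping.lookup \<alpha> i = 0" for i
      using 0(1) \<alpha> unfolding homogeneous_polys_def by (cases "i \<in> Poly_Mapping.keys \<alpha>") (auto simp: in_keys_iff)
    then show "\<alpha> \<in> {0}"
      by (auto intro: poly_mapping_eqI)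
  qed
  then have "poly_eval c p = Poly_Mapping.lookup p 0" for c
    by (subst poly_eval_superset[of "{0}"]) auto
  then have "Poly_Mapping.lookup p 0 = 0"
    using 0(2) by simp
  then show ?case
    using \<open>Poly_Mapping.keys p \<subseteq> {0}\<close> by (metis keys_eq_empty in_keys_iff subset_singletonD insertI1)
next
  case (Suc k)
  have "partial_deriv i p = 0" for i
  proof (rule Suc.IH)
    show "partial_deriv i p \<in> homogeneous_polys m k"
      using partial_deriv_homogeneous[OF Suc.prems(1)] by simp
    show "poly_eval c (partial_deriv i p) = 0" for c
    proof -
      have "((\<lambda>t. 0) has_field_derivative poly_eval (c(i := c i)) (partial_deriv i p)) (at (c i))"
        using poly_eval_DERIV[of c i p "c i"] Suc.prems(2) by simp
      then show ?thesis
        by (metis DERIV_const DERIV_unique fun_upd_triv)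
    qed
  qed
  \<comment> \<open>Coefficients at monomials divisible by a variable vanish, and in positive degree
    every monomial is divisible by one.\<close>
  then have *: "Poly_Mapping.lookup p (\<beta> + Poly_Mapping.single i 1) = 0" for i \<beta>
    using lookup_partial_deriv[of i p \<beta>] by simp
  show ?case
  proof (rule poly_mapping_eqI, rule ccontr)
    fix \<alpha> assume "Poly_Mapping.lookup p \<alpha> \<noteq> Poly_Mapping.lookup 0 \<alpha>"
    then have \<alpha>: "Poly_Mapping.lookup p \<alpha> \<noteq> 0" by simp
    then have "\<alpha> \<in> Poly_Mapping.keys p" by (simp add: in_keys_iff)
    then have "(\<Sum>i\<in>{1..m}. Poly_Mapping.lookup \<alpha> i) = Suc k"
      using Suc.prems(1) by (auto simp: homogeneous_polys_iff)
    then obtain i where "Poly_Mapping.lookup \<alpha> i \<noteq> 0"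
      by (metis nat.distinct(1) sum.neutral)
    then have "\<alpha> = (\<alpha> - Poly_Mapping.single i 1) + Poly_Mapping.single i 1"
      by (intro poly_mapping_eqI) (auto simp: lookup_add lookup_minus lookup_single when_def)
    with * \<alpha> show False by metis
  qed
qed


section \<open>Independent families and determinants\<close>

text \<open>Independence of an indexed family rather than of its image: a repeated vector makes the
  family dependent, as it must for vertices of a simplex.\<close>

definition indep_family :: "(nat \<Rightarrow> 'v::real_vector) \<Rightarrow> nat set \<Rightarrow> bool" where
  "indep_family lam I \<longleftrightarrow> (\<forall>t. (\<Sum>i\<in>I. t i *\<^sub>R lam i) = 0 \<longrightarrow> (\<forall>i\<in>I. t i = 0))"

lemma indep_family_iff:
  assumes "finite I"
  shows "indep_family lam I \<longleftrightarrow> inj_on lam I \<and> independent (lam ` I)"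
proof
  assume indep: "indep_family lam I"
  have inj: "inj_on lam I"
  proof (rule inj_onI, rule ccontr)
    fix i j assume ij: "i \<in> I" "j \<in> I" "lam i = lam j" "i \<noteq> j"
    let ?t = "\<lambda>k. (if k = i then 1 else 0) - (if k = j then 1 else (0::real))"
    have "(\<Sum>k\<in>I. ?t k *\<^sub>R lam k) =
        (\<Sum>k\<in>I. if k = i then lam k else 0) - (\<Sum>k\<in>I. if k = j then lam k else 0)"
      unfolding sum_subtractf[symmetric] by (rule sum.cong) auto
    also have "\<dots> = 0"
      using ij assms by simp
    finally have "\<forall>k\<in>I. ?t k = 0"
      by (rule mp[OF spec[OF indep[unfolded indep_family_def], of ?t]])
    then have "?t i = 0"
      using ij(1) by blast
    then show False using ij(4) by simp
  qed
  moreover have "independent (lam ` I)"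
  proof
    assume "dependent (lam ` I)"
    then obtain u where u: "\<exists>v\<in>lam ` I. u v \<noteq> 0" "(\<Sum>v\<in>lam ` I. u v *\<^sub>R v) = 0"
      using dependent_finite[of "lam ` I"] assms by auto
    then have "(\<Sum>i\<in>I. u (lam i) *\<^sub>R lam i) = 0"
      by (simp add: sum.reindex[OF inj])
    then have "\<forall>i\<in>I. u (lam i) = 0"
      using indep unfolding indep_family_def by (elim allE[of _ "\<lambda>i. u (lam i)"]) simp
    then show False using u(1) by auto
  qed
  ultimately show "inj_on lam I \<and> independent (lam ` I)" ..
next
  assume *: "inj_on lam I \<and> independent (lam ` I)"
  show "indep_family lam I"
    unfolding indep_family_def
  proof (intro allI impI ballI)
    fix t i assume t: "(\<Sum>i\<in>I. t i *\<^sub>R lam i) = 0" and i: "i \<in> I"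
    let ?u = "\<lambda>v. t (the_inv_into I lam v)"
    have "(\<Sum>v\<in>lam ` I. ?u v *\<^sub>R v) = (\<Sum>i\<in>I. t i *\<^sub>R lam i)"
      using * by (subst sum.reindex) (auto simp: the_inv_into_f_f)
    then have sum0: "(\<Sum>v\<in>lam ` I. ?u v *\<^sub>R v) = 0"
      using t by simp
    have "?u v = 0" if "v \<in> lam ` I" for v
    proof (rule ccontr)
      assume "?u v \<noteq> 0"
      then have "dependent (lam ` I)"
        unfolding dependent_finite[OF finite_imageI[OF assms]]
        by (intro exI[of _ ?u] conjI bexI[of _ v] that sum0)
      then show False using * by simp
    qed
    from this[of "lam i"] show "t i = 0"
      using * i by (simp add: the_inv_into_f_f)
  qed
qed

lemma indep_family_mono:
  assumes "indep_family lam I" "J \<subseteq> I" "finite I"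
  shows "indep_family lam J"
proof -
  have "inj_on lam I" "independent (lam ` I)"
    using assms by (simp_all add: indep_family_iff)
  then show ?thesis
    using assms(2) finite_subset[OF assms(2,3)]
    by (simp add: indep_family_iff inj_on_subset independent_mono[OF _ image_mono])
qed

section \<open>Bases and dual bases\<close>

lemma basis_on_iff:
  fixes lam :: "nat \<Rightarrow> 'v::euclidean_space"
  assumes "finite I" "card I = DIM('v)"
  shows "basis_on lam I \<longleftrightarrow> indep_family lam I"
proof
  assume "indep_family lam I"
  then have *: "inj_on lam I" "independent (lam ` I)"
    by (simp_all add: indep_family_iff assms)
  have "UNIV \<subseteq> span (lam ` I)"
    by (rule card_ge_dim_independent) (use * assms in \<open>auto simp: card_image\<close>)
  with * show "basis_on lam I"
    by (auto simp: basis_on_def)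
qed (simp add: basis_on_def indep_family_iff assms)

text \<open>The coordinate functional on the independent vectors extends linearly to the whole
  space, and \<open>adjoint f 1\<close> is the vector representing it.\<close>

lemma dual_vector_exists:
  fixes lam :: "nat \<Rightarrow> 'v::euclidean_space"
  assumes "indep_family lam I" "finite I"
  shows "\<exists>u. \<forall>j\<in>I. inner u (lam j) = (if i = j then 1 else 0)"
proof -
  have *: "inj_on lam I" "independent (lam ` I)"
    using assms by (simp_all add: indep_family_iff)
  obtain f :: "'v \<Rightarrow> real" where f: "linear f"
      "\<forall>x\<in>lam ` I. f x = (if i = the_inv_into I lam x then 1 else 0)"
    using linear_independent_extend[OF *(2), of "\<lambda>x. if i = the_inv_into I lam x then 1 else 0"]
    by blast
  have "inner (adjoint f 1) (lam j) = f (lam j)" for j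
    using adjoint_works[OF f(1), of "lam j" 1] by (simp add: inner_commute)
  then show ?thesis
    using f(2) * by (intro exI[of _ "adjoint f 1"]) (auto simp: the_inv_into_f_f)
qed

text \<open>The description defining \<open>dual_basis\<close> is met exactly once: the difference
  of two candidates at an index is orthogonal to a spanning set, hence to itself, and outside
  \<open>I\<close> the value is prescribed.\<close>

lemma dual_basis_props:
  fixes lam :: "nat \<Rightarrow> 'v::euclidean_space"
  assumes "basis_on lam I" "finite I"
  shows "i \<in> I \<Longrightarrow> j \<in> I \<Longrightarrow> inner (dual_basis lam I i) (lam j) = (if i = j then 1 else 0)"
    and "i \<notin> I \<Longrightarrow> dual_basis lam I i = 0"
proof -
  have indep: "indep_family lam I" and span: "span (lam ` I) = UNIV"
    using assms by (simp_all add: basis_on_def indep_family_iff)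
  let ?P = "\<lambda>u. (\<forall>i\<in>I. \<forall>j\<in>I. inner (u i) (lam j) = (if i = j then 1 else 0)) \<and> (\<forall>i. i \<notin> I \<longrightarrow> u i = 0)"
  have "\<forall>i. \<exists>u. \<forall>j\<in>I. inner u (lam j) = (if i = j then 1 else 0)"
    using dual_vector_exists[OF indep assms(2)] by simp
  from choice[OF this] obtain d where d: "\<And>i. \<forall>j\<in>I. inner (d i) (lam j) = (if i = j then 1 else 0)"
    by auto
  have "\<exists>!u. ?P u"
  proof (rule ex1I[of _ "\<lambda>i. if i \<in> I then d i else 0"])
    show "?P (\<lambda>i. if i \<in> I then d i else 0)"
      using d by auto
    fix u assume u: "?P u"
    show "u = (\<lambda>i. if i \<in> I then d i else 0)"
    proof
      fix i
      show "u i = (if i \<in> I then d i else 0)"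
      proof (cases "i \<in> I")
        case True
        have "real_inner_class.orthogonal (u i - d i) x" if "x \<in> span (lam ` I)" for x
          using that by (rule orthogonal_to_span)
            (use True u d in \<open>auto simp: real_inner_class.orthogonal_def inner_diff_left\<close>)
        then have "real_inner_class.orthogonal (u i - d i) (u i - d i)"
          using span by blast
        then show ?thesis
          using True by (simp add: orthogonal_self)
      qed (use u in auto)
    qed
  qed
  then have "?P (dual_basis lam I)"
    unfolding dual_basis_def by (rule theI')
  then show "i \<in> I \<Longrightarrow> j \<in> I \<Longrightarrow> inner (dual_basis lam I i) (lam j) = (if i = j then 1 else 0)"
    and "i \<notin> I \<Longrightarrow> dual_basis lam I i = 0"
    by auto
qed

lemma dual_basis_expand:
  fixes lam :: "nat \<Rightarrow> 'v::euclidean_space"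
  assumes "basis_on lam I" "finite I"
  shows "(\<Sum>i\<in>I. inner (dual_basis lam I i) v *\<^sub>R lam i) = v"
proof -
  have "v \<in> span (lam ` I)"
    using assms by (simp add: basis_on_def)
  then show ?thesis
  proof (induction rule: span_induct_alt)
    case base
    then show ?case by simp
  next
    case (step c x y)
    then obtain k where k: "k \<in> I" "x = lam k" by auto
    have "(\<Sum>i\<in>I. inner (dual_basis lam I i) (c *\<^sub>R x + y) *\<^sub>R lam i) =
        (\<Sum>i\<in>I. (c * inner (dual_basis lam I i) (lam k)) *\<^sub>R lam i) + y"
      by (simp add: step k inner_add_right scaleR_add_left sum.distrib)
    also have "(\<Sum>i\<in>I. (c * inner (dual_basis lam I i) (lam k)) *\<^sub>R lam i) =
        (\<Sum>i\<in>I. if i = k then c *\<^sub>R lam k else 0)"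
      by (rule sum.cong) (use dual_basis_props[OF assms] k in auto)
    finally show ?case
      using k assms by simp
  qed
qed

lemma dual_basis_sum:
  fixes lam :: "nat \<Rightarrow> 'v::euclidean_space"
  assumes "basis_on lam I" "finite I"
  shows "(\<Sum>i\<in>I. inner (dual_basis lam I i) v * inner x (lam i)) = inner x v"
proof -
  have "inner x v = inner x (\<Sum>i\<in>I. inner (dual_basis lam I i) v *\<^sub>R lam i)"
    by (simp add: dual_basis_expand[OF assms])
  then show ?thesis
    by (simp add: inner_sum_right)
qed

section \<open>Determinants in an orthonormal frame\<close>

lemma frame_orthogonal_eq_0:
  fixes e :: "'v::euclidean_space list"
  assumes "orthonormal_frame e" "\<And>j. j < DIM('v) \<Longrightarrow> inner (e ! j) x = 0"
  shows "x = 0"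
proof -
  have e: "length e = DIM('v)" "\<And>j k. j < DIM('v) \<Longrightarrow> k < DIM('v) \<Longrightarrow>
      inner (e ! j) (e ! k) = (if j = k then 1 else 0)"
    using assms(1) by (auto simp: orthonormal_frame_def)
  have dist: "distinct e"
    unfolding distinct_conv_nth using e by (metis zero_neq_one)
  have "pairwise real_inner_class.orthogonal (set e)"
    unfolding pairwise_def real_inner_class.orthogonal_def using e by (metis in_set_conv_nth)
  moreover have "0 \<notin> set e"
    using e by (metis in_set_conv_nth inner_zero_left zero_neq_one)
  ultimately have "independent (set e)"
    by (rule pairwise_orthogonal_independent)
  then have "UNIV \<subseteq> span (set e)"
    by (intro card_ge_dim_independent) (use dist e in \<open>auto simp: distinct_card\<close>)
  moreover have "real_inner_class.orthogonal x y" if "y \<in> span (set e)" for y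
    using that by (rule orthogonal_to_span)
      (use assms(2) e in \<open>auto simp: real_inner_class.orthogonal_def in_set_conv_nth inner_commute\<close>)
  ultimately show ?thesis
    by (metis UNIV_I orthogonal_self subsetD)
qed

text \<open>The columns of the matrix are the frame coordinates of the vectors, so its kernel
  vectors are exactly the linear relations of the family, read along the increasing enumeration of
  \<open>I\<close>.\<close>

lemma face_det_eq_0_iff:
  fixes e :: "'v::euclidean_space list"
  assumes "orthonormal_frame e" "finite I" "card I = DIM('v)"
  shows "face_det e lam I = 0 \<longleftrightarrow> \<not> indep_family lam I"
proof -
  let ?n = "DIM('v)"
  let ?s = "sorted_list_of_set I"
  let ?A = "Matrix.mat ?n ?n (\<lambda>(j, k). inner (e ! j) (map lam ?s ! k))"
  have len: "length ?s = ?n"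
    using assms by simp
  have bij: "bij_betw (\<lambda>k. ?s ! k) {..<?n} I"
    using bij_betw_nth[of ?s "{..<?n}" I] assms by simp
  have mult: "vec_index (?A *\<^sub>v v) j = inner (e ! j) (\<Sum>k<?n. (vec_index v k) *\<^sub>R lam (?s ! k))"
    if "v \<in> carrier_vec ?n" "j < ?n" for v j
  proof -
    have "vec_index (?A *\<^sub>v v) j = (\<Sum>k<?n. inner (e ! j) (map lam ?s ! k) * (vec_index v k))"
      using that by (auto simp: scalar_prod_def lessThan_atLeast0 intro!: sum.cong)
    then show ?thesis
      using len by (simp add: inner_sum_right mult.commute)
  qed
  have "face_det e lam I = 0 \<longleftrightarrow> (\<exists>v. v \<in> carrier_vec ?n \<and> v \<noteq> 0\<^sub>v ?n \<and> ?A *\<^sub>v v = 0\<^sub>v ?n)"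
    unfolding face_det_def frame_det_def by (rule det_0_iff_vec_prod_zero) simp
  also have "\<dots> \<longleftrightarrow> \<not> indep_family lam I"
  proof
    assume "\<exists>v. v \<in> carrier_vec ?n \<and> v \<noteq> 0\<^sub>v ?n \<and> ?A *\<^sub>v v = 0\<^sub>v ?n"
    then obtain v where v: "v \<in> carrier_vec ?n" "v \<noteq> 0\<^sub>v ?n" "?A *\<^sub>v v = 0\<^sub>v ?n"
      by blast
    have "(\<Sum>k<?n. (vec_index v k) *\<^sub>R lam (?s ! k)) = 0"
      by (rule frame_orthogonal_eq_0[OF assms(1)]) (use mult[OF v(1)] v(3) in \<open>metis index_zero_vec(1)\<close>)
    moreover define t where "t i = vec_index v (the_inv_into {..<?n} (\<lambda>k. ?s ! k) i)" for i
    have t: "t (?s ! k) = vec_index v k" if "k < ?n" for k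
      unfolding t_def using that bij by (subst the_inv_into_f_f) (auto simp: bij_betw_def)
    have "(\<Sum>i\<in>I. t i *\<^sub>R lam i) = (\<Sum>k<?n. t (?s ! k) *\<^sub>R lam (?s ! k))"
      by (rule sum.reindex_bij_betw[OF bij, symmetric])
    ultimately have sum0: "(\<Sum>i\<in>I. t i *\<^sub>R lam i) = 0"
      using t by simp
    obtain k where k: "k < ?n" "vec_index v k \<noteq> 0"
      using v by (metis carrier_vecD eq_vecI index_zero_vec)
    have "?s ! k \<in> I"
      using bij k(1) by (auto simp: bij_betw_def)
    with sum0 k t show "\<not> indep_family lam I"
      unfolding indep_family_def by metis
  next
    assume "\<not> indep_family lam I"
    then obtain t i where t: "(\<Sum>i\<in>I. t i *\<^sub>R lam i) = 0" "i \<in> I" "t i \<noteq> 0"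
      unfolding indep_family_def by blast
    let ?v = "Matrix.vec ?n (\<lambda>k. t (?s ! k))"
    have "(\<Sum>k<?n. (vec_index ?v k) *\<^sub>R lam (?s ! k)) = (\<Sum>i\<in>I. t i *\<^sub>R lam i)"
      by (subst sum.reindex_bij_betw[OF bij, symmetric]) simp
    then have 1: "?A *\<^sub>v ?v = 0\<^sub>v ?n"
      using t(1) by (intro eq_vecI) (simp_all add: mult del: index_mult_mat_vec)
    obtain k where "k < ?n" "i = ?s ! k"
      using t(2) bij by (auto simp: bij_betw_def)
    then have 2: "?v \<noteq> 0\<^sub>v ?n"
      using t(3) by (metis index_vec index_zero_vec(1))
    show "\<exists>v. v \<in> carrier_vec ?n \<and> v \<noteq> 0\<^sub>v ?n \<and> ?A *\<^sub>v v = 0\<^sub>v ?n"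
      using 1 2 by (intro exI[of _ ?v]) simp
  qed
  finally show ?thesis .
qed

text \<open>The position at which \<open>i\<close> enters the increasing list is the exponent of the
  sign in \<open>chain_boundary\<close>. This ties column expansions to the boundary map.\<close>

lemma sorted_list_of_set_insert_split:
  assumes "finite (J :: nat set)" "i \<notin> J"
  shows "\<exists>xs ys. sorted_list_of_set J = xs @ ys \<and>
    sorted_list_of_set (insert i J) = xs @ i # ys \<and> length xs = card {j\<in>J. j < i}"
proof -
  let ?L = "{j\<in>J. j < i}" and ?U = "{j\<in>J. i < j}"
  have fin: "finite ?L" "finite ?U"
    using assms by auto
  have J: "J = ?L \<union> ?U"
    using assms(2) by (auto simp: not_less_iff_gr_or_eq)
  let ?xs = "sorted_list_of_set ?L" and ?ys = "sorted_list_of_set ?U"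
  have set: "set (?xs @ ?ys) = J" "set (?xs @ i # ?ys) = insert i J"
    using fin J by auto
  have "sorted (?xs @ ?ys)" "distinct (?xs @ ?ys)" "sorted (?xs @ i # ?ys)" "distinct (?xs @ i # ?ys)"
    using fin by (auto simp: sorted_append)
  then have "sorted_list_of_set J = ?xs @ ?ys" "sorted_list_of_set (insert i J) = ?xs @ i # ?ys"
    using sorted_list_of_set.idem_if_sorted_distinct[of "?xs @ ?ys"]
      sorted_list_of_set.idem_if_sorted_distinct[of "?xs @ i # ?ys"] by (simp_all only: set)
  then show ?thesis
    using fin by (intro exI[of _ ?xs] exI[of _ ?ys]) auto
qed

text \<open>Expanding \<open>det (x, \<lambda>\<^sub>J)\<close> along the column of \<open>x\<close> gives the vector \<open>y\<close>.\<close>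

lemma facet_det_functional:
  fixes e :: "'v::euclidean_space list" and lam :: "nat \<Rightarrow> 'v"
  assumes "finite J" "card J = DIM('v) - 1"
  obtains y where
    "\<And>i. i \<notin> J \<Longrightarrow> face_det e lam (insert i J) = (-1) ^ card {j\<in>J. j < i} * inner y (lam i)"
    "\<And>i. i \<in> J \<Longrightarrow> inner y (lam i) = 0"
proof -
  let ?n = "DIM('v)"
  have n: "?n > 0" by simp
  define s where "s = map lam (sorted_list_of_set J)"
  have lens: "length s = ?n - 1"
    using assms by (simp add: s_def)
  \<comment> \<open>\<open>B r\<close> is the minor left after deleting row \<open>r\<close> and the
    column of the inserted vector. It does not depend on where that vector is inserted, so the
    position affects only the sign.\<close>
  define B where "B r = Matrix.mat (?n - 1) (?n - 1)
    (\<lambda>(j, k). inner (e ! (if j < r then j else Suc j)) (s ! k))" for r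
  define y where "y = (\<Sum>r<?n. ((-1) ^ r * Determinant.det (B r)) *\<^sub>R e ! r)"
  have expand: "frame_det e (xs @ x # ys) = (-1) ^ length xs * inner y x" if "s = xs @ ys" for xs ys x
  proof -
    let ?k = "length xs"
    let ?A = "Matrix.mat ?n ?n (\<lambda>(j, k). inner (e ! j) ((xs @ x # ys) ! k))"
    have k: "?k < ?n"
      using that lens n by (cases ys) auto
    have nth: "(xs @ x # ys) ! (if j < ?k then j else Suc j) = s ! j" for j
      unfolding that by (simp add: nth_append Suc_diff_le)
    have del: "mat_delete ?A r ?k = B r" if "r < ?n" for r
    proof (rule eq_matI)
      fix i j assume "i < dim_row (B r)" "j < dim_col (B r)"
      then have "i < ?n - 1" "j < ?n - 1"
        by (simp_all add: B_def)
      then have *: "(if i < r then i else Suc i) < ?n" "(if j < ?k then j else Suc j) < ?n"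
        by auto
      have "mat_delete ?A r ?k $$ (i, j) =
          inner (e ! (if i < r then i else Suc i)) ((xs @ x # ys) ! (if j < ?k then j else Suc j))"
        using \<open>i < ?n - 1\<close> \<open>j < ?n - 1\<close> *
        unfolding mat_delete_def by (subst index_mat(1)) (simp_all del: nth_append_length)
      then show "mat_delete ?A r ?k $$ (i, j) = B r $$ (i, j)"
        using \<open>i < ?n - 1\<close> \<open>j < ?n - 1\<close> by (simp only: nth) (simp add: B_def)
    qed (simp_all add: B_def mat_delete_def)
    have "Determinant.det ?A = (\<Sum>r<?n. ?A $$ (r, ?k) * cofactor ?A r ?k)"
      by (rule laplace_expansion_column) (use k in auto)
    also have "\<dots> = (\<Sum>r<?n. inner (e ! r) x * ((-1) ^ (r + ?k) * Determinant.det (B r)))"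
      by (rule sum.cong) (use k in \<open>auto simp: cofactor_def del\<close>)
    also have "\<dots> = (-1) ^ ?k * inner y x"
      by (simp add: y_def inner_sum_left sum_distrib_left power_add mult_ac)
    finally show ?thesis
      by (simp add: frame_det_def)
  qed
  show ?thesis
  proof
    fix i assume "i \<notin> J"
    then obtain xs ys where "sorted_list_of_set J = xs @ ys"
        "sorted_list_of_set (insert i J) = xs @ i # ys" "length xs = card {j\<in>J. j < i}"
      using sorted_list_of_set_insert_split[OF assms(1)] by blast
    then show "face_det e lam (insert i J) = (-1) ^ card {j\<in>J. j < i} * inner y (lam i)"
      using expand[of "map lam xs" "map lam ys" "lam i"] by (simp add: face_det_def s_def)
  next
    fix i assume "i \<in> J"
    then obtain k where k: "k < length s" "s ! k = lam i"
      using assms by (metis in_set_conv_nth length_map nth_map s_def set_sorted_list_of_set)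
    \<comment> \<open>With \<open>lam i\<close> placed in front of the columns for \<open>J\<close>,
      it occurs twice, so the determinant vanishes.\<close>
    let ?A = "Matrix.mat ?n ?n (\<lambda>(j, k). inner (e ! j) ((lam i # s) ! k))"
    have "Determinant.det ?A = 0"
      by (rule det_identical_columns[of _ ?n 0 "Suc k"]) (use k lens in auto)
    then have "frame_det e ([] @ lam i # s) = 0"
      by (simp add: frame_det_def)
    then show "inner y (lam i) = 0"
      using expand[of "[]" s "lam i"] by simp
  qed
qed


section \<open>Reduction to squarefree monomials\<close>

lemma card_set_mset_le_size: "card (set_mset \<alpha>) \<le> size \<alpha>"
  by (metis size_mset_set mset_set_set_mset_msubset size_mset_mono)

text \<open>Induction on the number of indices by which the support falls short of \<open>N\<close>:
  a monomial that is not squarefree has a repeated index, and \<open>step\<close> trades one copy of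
  it for indices outside the support.\<close>

lemma squarefree_reduction:
  fixes T :: "nat multiset \<Rightarrow> real"
  assumes sq: "\<And>I. I \<subseteq> {1..m} \<Longrightarrow> card I = N \<Longrightarrow> T (mset_set I) = 0"
    and step: "\<And>i \<beta>. i \<in># \<beta> \<Longrightarrow> set_mset \<beta> \<subseteq> {1..m} \<Longrightarrow> Suc (size \<beta>) = N \<Longrightarrow>
      \<exists>\<mu>. T (add_mset i \<beta>) = (\<Sum>j\<in>{1..m} - set_mset \<beta>. \<mu> j * T (add_mset j \<beta>))"
    and "set_mset \<alpha> \<subseteq> {1..m}" "size \<alpha> = N"
  shows "T \<alpha> = 0"
  using assms(3,4)
proof (induction "N - card (set_mset \<alpha>)" arbitrary: \<alpha> rule: less_induct)
  case less
  show ?case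
  proof (cases "\<alpha> = mset_set (set_mset \<alpha>)")
    case True
    then have "card (set_mset \<alpha>) = N"
      using less.prems(2) by (metis size_mset_set)
    then have "T (mset_set (set_mset \<alpha>)) = 0"
      using sq less.prems(1) by blast
    with True show ?thesis by simp
  next
    case False
    then obtain i where "count \<alpha> i \<noteq> count (mset_set (set_mset \<alpha>)) i"
      by (metis multiset_eq_iff)
    then have i: "count \<alpha> i \<ge> 2"
      by (cases "i \<in># \<alpha>") (auto simp: not_in_iff numeral_2_eq_2 Suc_le_eq intro: le_neq_implies_less)
    define \<beta> where "\<beta> = \<alpha> - {#i#}"
    have \<alpha>: "\<alpha> = add_mset i \<beta>" and "i \<in># \<beta>"
      using i by (auto simp: \<beta>_def in_diff_count count_greater_zero_iff[symmetric]
          simp del: count_greater_zero_iff)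
    have set: "set_mset \<alpha> = set_mset \<beta>"
      using \<alpha> \<open>i \<in># \<beta>\<close> by auto
    have size: "Suc (size \<beta>) = N"
      using less.prems(2) \<alpha> by simp
    obtain \<mu> where \<mu>: "T (add_mset i \<beta>) = (\<Sum>j\<in>{1..m} - set_mset \<beta>. \<mu> j * T (add_mset j \<beta>))"
      using step[OF \<open>i \<in># \<beta>\<close> _ size] less.prems(1) set by blast
    have "T (add_mset j \<beta>) = 0" if j: "j \<in> {1..m} - set_mset \<beta>" for j
    proof (rule less.hyps)
      show "N - card (set_mset (add_mset j \<beta>)) < N - card (set_mset \<alpha>)"
        \<comment> \<open>The old support has at most \<open>size \<beta> < N\<close> elements, so
          enlarging it strictly decreases the truncated difference.\<close>
        using card_set_mset_le_size[of \<beta>] size j set by simp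
    qed (use less.prems j set size in auto)
    then have "T (add_mset i \<beta>) = 0"
      unfolding \<mu> by (intro sum.neutral) simp
    then show ?thesis
      using \<alpha> by simp
  qed
qed

text \<open>Pairing with a vector dual to \<open>lam i\<close> on the support isolates
  \<open>T (add_mset i \<beta>)\<close> in the relation; if no such vector exists, the support is
  dependent and \<open>dep\<close> applies. The lemma is used for differences of two functionals
  obeying the same relations.\<close>

lemma functional_eq_0:
  fixes T :: "nat multiset \<Rightarrow> real" and lam :: "nat \<Rightarrow> 'v::euclidean_space"
  assumes sq: "\<And>I. I \<subseteq> {1..m} \<Longrightarrow> card I = N \<Longrightarrow> T (mset_set I) = 0"
    and dep: "\<And>\<alpha>. set_mset \<alpha> \<subseteq> {1..m} \<Longrightarrow> size \<alpha> = N \<Longrightarrow>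
      \<not> indep_family lam (set_mset \<alpha>) \<Longrightarrow> T \<alpha> = 0"
    and rel: "\<And>\<beta> u. set_mset \<beta> \<subseteq> {1..m} \<Longrightarrow> Suc (size \<beta>) = N \<Longrightarrow>
      (\<Sum>j\<in>{1..m}. inner u (lam j) * T (add_mset j \<beta>)) = 0"
    and "set_mset \<alpha> \<subseteq> {1..m}" "size \<alpha> = N"
  shows "T \<alpha> = 0"
proof (rule squarefree_reduction[where T = T, OF sq _ assms(4,5)])
  fix i and \<beta> :: "nat multiset"
  assume \<beta>: "i \<in># \<beta>" "set_mset \<beta> \<subseteq> {1..m}" "Suc (size \<beta>) = N"
  show "\<exists>\<mu>. T (add_mset i \<beta>) = (\<Sum>j\<in>{1..m} - set_mset \<beta>. \<mu> j * T (add_mset j \<beta>))"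
  proof (cases "indep_family lam (set_mset \<beta>)")
    case True
    then obtain u where u: "\<forall>j\<in>set_mset \<beta>. inner u (lam j) = (if i = j then 1 else 0)"
      using dual_vector_exists[OF True, of i] by auto
    have "0 = (\<Sum>j\<in>set_mset \<beta>. inner u (lam j) * T (add_mset j \<beta>)) +
        (\<Sum>j\<in>{1..m} - set_mset \<beta>. inner u (lam j) * T (add_mset j \<beta>))"
      using rel[OF \<beta>(2,3), of u] sum.subset_diff[OF \<beta>(2) finite_atLeastAtMost,
        of "\<lambda>j. inner u (lam j) * T (add_mset j \<beta>)"] by simp
    also have "(\<Sum>j\<in>set_mset \<beta>. inner u (lam j) * T (add_mset j \<beta>)) =
        (\<Sum>j\<in>set_mset \<beta>. if i = j then T (add_mset j \<beta>) else 0)"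
      by (rule sum.cong) (use u in auto)
    also have "\<dots> = T (add_mset i \<beta>)"
      using \<beta>(1) by simp
    finally show ?thesis
      by (intro exI[of _ "\<lambda>j. - inner u (lam j)"]) (simp add: sum_negf)
  next
    case False
    have "set_mset (add_mset i \<beta>) = set_mset \<beta>"
      using \<beta>(1) by auto
    then have "T (add_mset i \<beta>) = 0"
      using dep[of "add_mset i \<beta>"] \<beta> False by simp
    then show ?thesis
      by (intro exI[of _ "\<lambda>_. 0"]) simp
  qed
qed

section \<open>A common point off finitely many hyperplanes\<close>

lemma common_nonvanishing:
  fixes F :: "('a::real_vector \<Rightarrow> real) set"
  assumes "finite F" "subspace S" "\<And>f. f \<in> F \<Longrightarrow> linear f" "\<And>f. f \<in> F \<Longrightarrow> \<exists>x\<in>S. f x \<noteq> 0"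
  shows "\<exists>x\<in>S. \<forall>f\<in>F. f x \<noteq> 0"
  using assms(1,3,4)
proof (induction F rule: finite_induct)
  case empty
  then show ?case using assms(2) subspace_0 by blast
next
  case (insert f F)
  obtain x where x: "x \<in> S" "\<forall>g\<in>F. g x \<noteq> 0"
    using insert by auto
  obtain y where y: "y \<in> S" "f y \<noteq> 0"
    using insert.prems(2) by auto
  \<comment> \<open>On the line \<open>x + t y\<close> each functional rules out at most one value
    of \<open>t\<close>. If \<open>g y = 0\<close>, the quotient is 0 and merely excludes one value
    more.\<close>
  have "\<exists>t. t \<notin> (\<lambda>g. - g x / g y) ` insert f F"
    using insert.hyps(1) by (intro ex_new_if_finite) (auto simp: infinite_UNIV_char_0)
  then obtain t where t: "t \<notin> (\<lambda>g. - g x / g y) ` insert f F" ..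
  have "g (x + t *\<^sub>R y) \<noteq> 0" if g: "g \<in> insert f F" for g
  proof
    assume "g (x + t *\<^sub>R y) = 0"
    then have *: "g x + t * g y = 0"
      using insert.prems(1)[OF g] by (simp add: linear_add linear_scale)
    show False
    proof (cases "g y = 0")
      case True
      then show False using * x y g by auto
    next
      case False
      then have "t = - g x / g y"
        using * by (simp add: field_simps)
      then show False using t g by blast
    qed
  qed
  moreover have "x + t *\<^sub>R y \<in> S"
    using x y assms(2) by (simp add: subspace_add subspace_scale)
  ultimately show ?case by blast
qed


section \<open>The volume polynomial\<close>

lemma linear_form_eval:
  "poly_eval a ((\<Sum>i\<in>A. c i *\<^sub>R poly_var i) ^ k) = (\<Sum>i\<in>A. c i * a i) ^ k"
  by (simp add: poly_eval_power poly_eval_sum poly_eval_scaleR)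

locale multifan =
  fixes e :: "'v::euclidean_space list" and m :: nat
    and w :: "nat set \<Rightarrow> real" and lam :: "nat \<Rightarrow> 'v"
  assumes frame: "orthonormal_frame e"
    and complete: "complete_multifan e m w lam"
begin

definition faces :: "nat set set" where
  "faces = support_faces TYPE('v) m w"

abbreviation generic :: "'v set" where
  "generic \<equiv> generic_vectors m w lam"

text \<open>The value of \<open>\<iota>\<^sub>J(x\<^sub>i)\<close> at \<open>v\<close>, that is, the
  coordinate of \<open>v\<close> at \<open>lam i\<close> in the basis of the face
  \<open>J\<close>.\<close>

definition coord :: "nat set \<Rightarrow> 'v \<Rightarrow> nat \<Rightarrow> real" where
  "coord J v i = (if i \<in> J then inner (dual_basis lam J i) v else 0)"

text \<open>The factor in the summand of \<open>J\<close> that does not involve the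
  integrand.\<close>

definition weight :: "nat set \<Rightarrow> 'v \<Rightarrow> real" where
  "weight J v = w J / (\<bar>face_det e lam J\<bar> * (\<Prod>i\<in>J. coord J v i))"

text \<open>
  \<open>localized v c \<alpha> k\<close> is the value at \<open>v\<close> of the rational function defining the integral of
  \<open>x\<^sup>\<alpha> (c\<^sub>1 x\<^sub>1 + \<dots> + c\<^sub>m x\<^sub>m)\<^sup>k\<close>.
\<close>

definition localized :: "'v \<Rightarrow> (nat \<Rightarrow> real) \<Rightarrow> nat multiset \<Rightarrow> nat \<Rightarrow> real" where
  "localized v c \<alpha> k = (\<Sum>J\<in>faces. weight J v * (\<Prod>i\<in>#\<alpha>. coord J v i) *
     (\<Sum>i\<in>{1..m}. c i * coord J v i) ^ k)"

text \<open>With exponent 0 the power of the linear form is 1 whatever \<open>c\<close> is; the zero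
  function is a placeholder.\<close>

abbreviation moment :: "'v \<Rightarrow> nat multiset \<Rightarrow> real" where
  "moment v \<alpha> \<equiv> localized v (\<lambda>_. 0) \<alpha> 0"

lemma localized_0: "localized v c \<alpha> 0 = moment v \<alpha>"
  by (simp add: localized_def)

lemma facesD:
  assumes "J \<in> faces"
  shows "finite J" "J \<subseteq> {1..m}" "card J = DIM('v)" "w J \<noteq> 0" "basis_on lam J" "indep_family lam J"
    "face_det e lam J \<noteq> 0"
proof -
  show *: "finite J" "J \<subseteq> {1..m}" "card J = DIM('v)" "w J \<noteq> 0"
    using assms by (auto simp: faces_def support_faces_def nsets_def)
  show "basis_on lam J"
    using assms complete by (auto simp: faces_def support_faces_def complete_multifan_def)
  then show "indep_family lam J"
    using basis_on_iff * by blast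
  then show "face_det e lam J \<noteq> 0"
    using face_det_eq_0_iff frame * by blast
qed

lemma in_facesI: "J \<subseteq> {1..m} \<Longrightarrow> card J = DIM('v) \<Longrightarrow> w J \<noteq> 0 \<Longrightarrow> J \<in> faces"
  by (auto simp: faces_def support_faces_def nsets_def finite_subset)

lemma finite_faces: "finite faces"
  by (rule finite_subset[of _ "Pow {1..m}"]) (auto simp: faces_def support_faces_def nsets_def)

lemma iota_eq: "iota lam J x v = poly_eval (coord J v) x"
  unfolding iota_def coord_def ..

lemma generic_iff: "v \<in> generic \<longleftrightarrow> (\<forall>J\<in>faces. \<forall>i\<in>J. coord J v i \<noteq> 0)"
  by (simp add: generic_vectors_def faces_def iota_eq)

lemma coord_sum:
  assumes "J \<in> faces"
  shows "(\<Sum>i\<in>J. coord J v i * inner u (lam i)) = inner u v"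
  using dual_basis_sum[of lam J v u] facesD[OF assms] by (simp add: coord_def)

lemma coord_sum_all:
  assumes "J \<in> faces"
  shows "(\<Sum>i\<in>{1..m}. inner u (lam i) * coord J v i) = inner u v"
proof -
  have "(\<Sum>i\<in>{1..m}. inner u (lam i) * coord J v i) = (\<Sum>i\<in>J. inner u (lam i) * coord J v i)"
    by (rule sum.mono_neutral_right) (use facesD[OF assms] in \<open>auto simp: coord_def\<close>)
  then show ?thesis
    using coord_sum[OF assms, of v u] by (simp add: mult.commute)
qed

text \<open>There are finitely many denominators, and none of them is the zero functional: a dual
  basis vector takes the value 1 at its own basis vector.\<close>

lemma generic_nonempty: "generic \<noteq> {}"
proof -
  let ?F = "(\<lambda>(J, i) v. inner (dual_basis lam J i) v) ` (SIGMA J:faces. J)"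
  have "\<exists>x\<in>UNIV. \<forall>f\<in>?F. f x \<noteq> 0"
  proof (rule common_nonvanishing)
    show "finite ?F"
      using finite_faces facesD(1) by auto
    fix f assume "f \<in> ?F"
    then obtain J i where f: "J \<in> faces" "i \<in> J" "f = inner (dual_basis lam J i)"
      by auto
    show "linear f"
      unfolding f(3) by (simp add: bounded_linear.linear bounded_linear_inner_right)
    have "f (lam i) = 1"
      using f dual_basis_props(1)[of lam J i i] facesD[OF f(1)] by simp
    then show "\<exists>x\<in>UNIV. f x \<noteq> 0"
      by (intro bexI[of _ "lam i"]) auto
  qed simp
  then obtain x where x: "\<forall>f\<in>?F. f x \<noteq> 0" by blast
  have "coord J x i \<noteq> 0" if "J \<in> faces" "i \<in> J" for J i
    using x that by (auto simp: coord_def)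
  then have "x \<in> generic"
    by (simp add: generic_iff)
  then show ?thesis by blast
qed

section \<open>Relations between moments\<close>

lemma localized_Suc:
  "localized v c \<alpha> (Suc k) = (\<Sum>i\<in>{1..m}. c i * localized v c (add_mset i \<alpha>) k)"
proof -
  have "localized v c \<alpha> (Suc k) = (\<Sum>J\<in>faces. \<Sum>i\<in>{1..m}. c i * (weight J v *
      (coord J v i * (\<Prod>i\<in>#\<alpha>. coord J v i)) * (\<Sum>i\<in>{1..m}. c i * coord J v i) ^ k))"
    unfolding localized_def power_Suc
    by (intro sum.cong refl) (simp add: sum_distrib_left sum_distrib_right mult_ac)
  also have "\<dots> = (\<Sum>i\<in>{1..m}. c i * localized v c (add_mset i \<alpha>) k)"
    by (subst sum.swap) (simp add: localized_def sum_distrib_left)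
  finally show ?thesis .
qed

text \<open>Expanding \<open>v\<close> in the basis of a face shows that the linear form with
  coefficients \<open>inner u (lam i)\<close> takes the value \<open>inner u v\<close> on every
  face. This common factor leaves the sum.\<close>

lemma localized_linear_relation:
  "(\<Sum>i\<in>{1..m}. inner u (lam i) * localized v c (add_mset i \<alpha>) k) = inner u v * localized v c \<alpha> k"
proof -
  have "(\<Sum>i\<in>{1..m}. inner u (lam i) * localized v c (add_mset i \<alpha>) k) =
      (\<Sum>J\<in>faces. (\<Sum>i\<in>{1..m}. inner u (lam i) * coord J v i) *
        (weight J v * (\<Prod>i\<in>#\<alpha>. coord J v i) * (\<Sum>i\<in>{1..m}. c i * coord J v i) ^ k))"
    unfolding localized_def sum_distrib_left sum_distrib_right
    by (subst sum.swap) (simp add: mult_ac)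
  also have "\<dots> = inner u v * localized v c \<alpha> k"
    unfolding localized_def sum_distrib_left
    by (intro sum.cong refl) (simp only: coord_sum_all)
  finally show ?thesis .
qed

lemma prod_mset_coord_eq_0:
  assumes "\<not> set_mset \<alpha> \<subseteq> J"
  shows "(\<Prod>i\<in>#\<alpha>. coord J v i) = 0"
proof -
  obtain i where "i \<in># \<alpha>" "i \<notin> J"
    using assms by blast
  then have "coord J v i \<in># image_mset (coord J v) \<alpha>" "coord J v i = 0"
    by (simp_all add: coord_def)
  then show ?thesis
    by (metis prod_mset_zero_iff)
qed

text \<open>A coordinate vanishes at an index outside the face, so only faces containing the support
  contribute.\<close>

lemma localized_eq_0:
  assumes "\<And>J. J \<in> faces \<Longrightarrow> \<not> set_mset \<alpha> \<subseteq> J"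
  shows "localized v c \<alpha> k = 0"
  unfolding localized_def by (intro sum.neutral ballI) (simp add: prod_mset_coord_eq_0[OF assms])

lemma localized_dependent:
  assumes "\<not> indep_family lam (set_mset \<alpha>)"
  shows "localized v c \<alpha> k = 0"
proof (rule localized_eq_0)
  fix J assume "J \<in> faces"
  then show "\<not> set_mset \<alpha> \<subseteq> J"
    using assms indep_family_mono[of lam J "set_mset \<alpha>"] facesD(1,6)[of J] by auto
qed

text \<open>By cardinality only the face \<open>I\<close> itself can contain \<open>I\<close>, and
  there the monomial cancels the coordinates in the denominator.\<close>

lemma moment_face:
  assumes "v \<in> generic" "I \<subseteq> {1..m}" "card I = DIM('v)"
  shows "moment v (mset_set I) = w I / \<bar>face_det e lam I\<bar>"
proof (cases "I \<in> faces")
  case True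
  have "\<not> I \<subseteq> J" if "J \<in> faces - {I}" for J
    using that facesD[of J] assms(3) card_subset_eq[of J I] by auto
  then have "moment v (mset_set I) =
      (\<Sum>J\<in>{I}. weight J v * (\<Prod>i\<in>#mset_set I. coord J v i))"
    unfolding localized_def
    using True finite_faces facesD(1)[OF True]
    by (intro sum.mono_neutral_cong_right) (auto simp: prod_mset_coord_eq_0)
  also have "\<dots> = w I / \<bar>face_det e lam I\<bar>"
    using assms(1) True facesD[OF True] by (simp add: weight_def generic_iff prod_unfold_prod_mset[symmetric])
  finally show ?thesis .
next
  case False
  then have "w I = 0"
    using assms in_facesI by blast
  moreover have "moment v (mset_set I) = 0"
  proof (rule localized_eq_0)
    fix J assume J: "J \<in> faces"
    show "\<not> set_mset (mset_set I) \<subseteq> J"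
      using facesD[OF J] J assms False card_subset_eq[of J I] finite_subset[OF assms(2)] by auto
  qed
  ultimately show ?thesis by simp
qed

text \<open>
  Up to sign, \<open>\<langle>y, \<cdot>\<rangle> = det (\<cdot>, \<lambda>\<^sub>J)\<close>. By Cramer's rule it turns the sum over the faces containing \<open>J\<close> into the
  coefficient of \<open>J\<close> in the boundary.
\<close>

lemma moment_facet:
  assumes "v \<in> generic" "J \<subseteq> {1..m}" "card J = DIM('v) - 1"
  shows "moment v (mset_set J) = 0"
proof (cases "\<exists>I\<in>faces. J \<subseteq> I")
  case False
  have "finite J"
    using assms(2) finite_subset by blast
  then show ?thesis
    using False by (intro localized_eq_0) simp
next
  case True
  have fin: "finite J"
    using assms(2) finite_subset by blast
  obtain y where y:
    "\<And>i. i \<notin> J \<Longrightarrow> face_det e lam (insert i J) = (-1) ^ card {j\<in>J. j < i} * inner y (lam i)"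
    "\<And>i. i \<in> J \<Longrightarrow> inner y (lam i) = 0"
    by (rule facet_det_functional[OF fin assms(3), where e = e and lam = lam]) (rule that, simp_all)
  let ?X = "{1..m} - J"
  \<comment> \<open>Since \<open>y\<close> is orthogonal to all \<open>lam k\<close> with
    \<open>k\<close> in \<open>J\<close>, only the coordinate at the added vertex survives when
    \<open>v\<close> is expanded.\<close>
  have cramer: "inner y v = coord (insert i J) v i * inner y (lam i)"
    if "i \<in> ?X" "insert i J \<in> faces" for i
  proof -
    have "inner y v = (\<Sum>k\<in>insert i J. coord (insert i J) v k * inner y (lam k))"
      using coord_sum[OF that(2), of v y] by simp
    then show ?thesis
      using that(1) fin y(2) by simp
  qed
  \<comment> \<open>The monomial cancels every coordinate in the denominator except that of
    \<open>i\<close>, and \<open>inner y v\<close> supplies this one together with the determinant.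
    The quotient of the determinant by its absolute value is the orientation sign.\<close>
  have summand: "weight (insert i J) v * (\<Prod>k\<in>#mset_set J. coord (insert i J) v k) * inner y v =
      (-1) ^ card {j\<in>J. j < i} * multifan_chain e w lam (insert i J)"
    if i: "i \<in> ?X" "insert i J \<in> faces" for i
  proof -
    let ?d = "face_det e lam (insert i J)"
    let ?P = "\<Prod>k\<in>J. coord (insert i J) v k"
    have "coord (insert i J) v k \<noteq> 0" if "k \<in> insert i J" for k
      using assms(1) i(2) that unfolding generic_iff by blast
    then have ne: "coord (insert i J) v i \<noteq> 0" "?P \<noteq> 0"
      using fin by auto
    have d: "?d \<noteq> 0"
      by (rule facesD(7)[OF i(2)])
    have inner: "inner y (lam i) = (-1) ^ card {j\<in>J. j < i} * ?d"
      using y(1)[of i] i(1) by simp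
    have "weight (insert i J) v * (\<Prod>k\<in>#mset_set J. coord (insert i J) v k) =
        w (insert i J) / (\<bar>?d\<bar> * coord (insert i J) v i)"
      using i(1) fin ne by (simp add: weight_def prod_unfold_prod_mset[symmetric])
    then show ?thesis
      using ne d unfolding cramer[OF i] inner multifan_chain_def real_sgn_eq by simp
  qed
  have supsets: "{I\<in>faces. J \<subseteq> I} = (\<lambda>i. insert i J) ` {i\<in>?X. insert i J \<in> faces}"
  proof (intro subset_antisym subsetI)
    show "I \<in> {I\<in>faces. J \<subseteq> I}" if "I \<in> (\<lambda>i. insert i J) ` {i\<in>?X. insert i J \<in> faces}" for I
      using that by blast
    fix I assume I: "I \<in> {I\<in>faces. J \<subseteq> I}"
    then have "card (I - J) = 1"
      using facesD(3)[of I] assms(3) fin DIM_positive[where 'a = 'v] by (simp add: card_Diff_subset)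
    then obtain i where "I - J = {i}"
      by (rule card_1_singletonE)
    moreover have "J \<subseteq> I" "I \<subseteq> {1..m}"
      using I facesD(2)[of I] by simp_all
    ultimately have "I = insert i J" "i \<in> ?X"
      by blast+
    then show "I \<in> (\<lambda>i. insert i J) ` {i\<in>?X. insert i J \<in> faces}"
      using I by blast
  qed
  have "inj_on (\<lambda>i. insert i J) {i\<in>?X. insert i J \<in> faces}"
  proof (rule inj_onI)
    fix i j assume ij: "i \<in> {i\<in>?X. insert i J \<in> faces}" "insert i J = insert j J"
    then have "i \<in> insert j J"
      by (metis insertI1)
    with ij(1) show "i = j"
      by simp
  qed
  moreover have "moment v (mset_set J) =
      (\<Sum>I\<in>{I\<in>faces. J \<subseteq> I}. weight I v * (\<Prod>k\<in>#mset_set J. coord I v k))"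
    unfolding localized_def
    by (intro sum.mono_neutral_cong_right) (simp_all add: finite_faces fin prod_mset_coord_eq_0)
  ultimately have "moment v (mset_set J) * inner y v = (\<Sum>i\<in>{i\<in>?X. insert i J \<in> faces}.
      weight (insert i J) v * (\<Prod>k\<in>#mset_set J. coord (insert i J) v k) * inner y v)"
    unfolding supsets by (simp add: sum.reindex sum_distrib_right)
  also have "\<dots> = (\<Sum>i\<in>{i\<in>?X. insert i J \<in> faces}.
      (-1) ^ card {j\<in>J. j < i} * multifan_chain e w lam (insert i J))"
    by (rule sum.cong) (simp_all add: summand)
  also have "\<dots> = chain_boundary m (multifan_chain e w lam) J"
    unfolding chain_boundary_def
  proof (rule sum.mono_neutral_left)
    show "{i\<in>?X. insert i J \<in> faces} \<subseteq> ?X"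
      by blast
    show "\<forall>i\<in>?X - {i\<in>?X. insert i J \<in> faces}.
        (-1) ^ card {j\<in>J. j < i} * multifan_chain e w lam (insert i J) = 0"
    proof
      fix i assume i: "i \<in> ?X - {i\<in>?X. insert i J \<in> faces}"
      have "card (insert i J) = DIM('v)"
        using i fin assms(3) by simp
      moreover have "insert i J \<subseteq> {1..m}" "insert i J \<notin> faces"
        using i assms(2) by blast+
      ultimately have "w (insert i J) = 0"
        using in_facesI by blast
      then show "(-1) ^ card {j\<in>J. j < i} * multifan_chain e w lam (insert i J) = 0"
        by (simp add: multifan_chain_def)
    qed
  qed simp_all
  also have "\<dots> = 0"
    using complete assms fin by (simp add: complete_multifan_def nsets_def)
  finally have "moment v (mset_set J) * inner y v = 0" .
  \<comment> \<open>A face containing \<open>J\<close> exists in this case, and for it both factors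
    in \<open>cramer\<close> are nonzero.\<close>
  moreover have "inner y v \<noteq> 0"
  proof -
    have "{I\<in>faces. J \<subseteq> I} \<noteq> {}"
      using True by blast
    then obtain i where i: "i \<in> ?X" "insert i J \<in> faces"
      unfolding supsets by blast
    then have "coord (insert i J) v i \<noteq> 0" "face_det e lam (insert i J) \<noteq> 0"
      using assms(1) facesD(7) by (simp_all add: generic_iff)
    then show ?thesis
      using cramer[OF i] y(1)[of i] i(1) by simp
  qed
  ultimately show ?thesis by simp
qed

text \<open>
  The relation used in the reduction comes from a vector \<open>u\<close> orthogonal to \<open>v\<close>, so that no moment of
  lower degree enters.
\<close>

lemma moment_lower:
  assumes "v \<in> generic" "set_mset \<alpha> \<subseteq> {1..m}" "size \<alpha> = DIM('v) - 1"
  shows "moment v \<alpha> = 0"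
proof (rule squarefree_reduction[where T = "moment v", OF moment_facet[OF assms(1)] _ assms(2,3)])
  fix i and \<beta> :: "nat multiset"
  assume \<beta>: "i \<in># \<beta>" "set_mset \<beta> \<subseteq> {1..m}" "Suc (size \<beta>) = DIM('v) - 1"
  show "\<exists>\<mu>. moment v (add_mset i \<beta>) = (\<Sum>j\<in>{1..m} - set_mset \<beta>. \<mu> j * moment v (add_mset j \<beta>))"
  proof (cases "\<exists>J\<in>faces. set_mset \<beta> \<subseteq> J")
    case True
    then obtain J where J: "J \<in> faces" "set_mset \<beta> \<subseteq> J" by blast
    have "card (set_mset \<beta>) < card J"
      using card_set_mset_le_size[of \<beta>] \<beta>(3) facesD(3)[OF J(1)] by simp
    \<comment> \<open>The multiset \<beta> has size \<open>DIM('v) - 2\<close>, which leaves a spare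
      vertex in \<open>J\<close>.\<close>
    then obtain j where j: "j \<in> J" "j \<notin> set_mset \<beta>"
      by (metis card_mono finite_set_mset not_le subsetI)
    \<comment> \<open>The multiple of the dual vector at \<open>j\<close> makes \<open>u\<close>
      orthogonal to \<open>v\<close> without changing its pairings on the support of \<beta>. The
      quotient makes sense because \<open>v\<close> is generic.\<close>
    define u where "u = dual_basis lam J i - (coord J v i / coord J v j) *\<^sub>R dual_basis lam J j"
    have i: "i \<in> J"
      using J \<beta>(1) by blast
    have dual: "inner (dual_basis lam J k) (lam l) = (if k = l then 1 else 0)"
      if "k \<in> J" "l \<in> J" for k l
      by (rule dual_basis_props(1)) (use that facesD[OF J(1)] in auto)
    have u: "inner u (lam k) = (if i = k then 1 else 0)" if "k \<in># \<beta>" for k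
      using that J j dual[OF i, of k] dual[OF j(1), of k] by (auto simp: u_def inner_diff_left)
    have uv: "inner u v = 0"
    proof -
      have "inner u v = coord J v i - coord J v i / coord J v j * coord J v j"
        using i j(1) by (simp add: u_def inner_diff_left coord_def)
      then show ?thesis
        using assms(1) J(1) j(1) by (simp add: generic_iff)
    qed
    have "0 = (\<Sum>k\<in>set_mset \<beta>. inner u (lam k) * moment v (add_mset k \<beta>)) +
        (\<Sum>k\<in>{1..m} - set_mset \<beta>. inner u (lam k) * moment v (add_mset k \<beta>))"
      using localized_linear_relation[of u v "\<lambda>_. 0" \<beta> 0] uv
        sum.subset_diff[OF \<beta>(2) finite_atLeastAtMost,
          of "\<lambda>k. inner u (lam k) * moment v (add_mset k \<beta>)"] by simp
    also have "(\<Sum>k\<in>set_mset \<beta>. inner u (lam k) * moment v (add_mset k \<beta>)) =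
        (\<Sum>k\<in>set_mset \<beta>. if i = k then moment v (add_mset k \<beta>) else 0)"
      by (rule sum.cong) (use u in auto)
    also have "\<dots> = moment v (add_mset i \<beta>)"
      using \<beta>(1) by simp
    finally show ?thesis
      by (intro exI[of _ "\<lambda>k. - inner u (lam k)"]) (simp add: sum_negf)
  next
    case False
    then have "moment v (add_mset i \<beta>) = 0"
      by (intro localized_eq_0) auto
    then show ?thesis
      by (intro exI[of _ "\<lambda>_. 0"]) simp
  qed
qed

section \<open>Independence of the generic vector and differentiation\<close>

lemma localized_lower:
  assumes "v \<in> generic" "set_mset \<alpha> \<subseteq> {1..m}" "size \<alpha> + k = DIM('v) - 1"
  shows "localized v c \<alpha> k = 0"
  using assms(2,3)
proof (induction k arbitrary: \<alpha>)
  case 0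
  then show ?case
    using moment_lower[OF assms(1), of \<alpha>] localized_0[of v c \<alpha>] by simp
next
  case (Suc k)
  then show ?case
    unfolding localized_Suc by (intro sum.neutral) simp
qed

text \<open>Moments of degree \<open>DIM('v) - 1\<close> vanish, so in top degree the relations
  become homogeneous and no longer involve \<open>v\<close>. The squarefree moments agree by
  \<open>moment_face\<close>, hence all do; expanding the power of the linear form gives the
  rest.\<close>

lemma localized_independent:
  assumes "v \<in> generic" "v' \<in> generic" "set_mset \<alpha> \<subseteq> {1..m}" "size \<alpha> + k = DIM('v)"
  shows "localized v c \<alpha> k = localized v' c \<alpha> k"
  using assms(3,4)
proof (induction k arbitrary: \<alpha>)
  case 0
  have "moment v \<alpha> - moment v' \<alpha> = 0"
  proof (rule functional_eq_0[where T = "\<lambda>\<alpha>. moment v \<alpha> - moment v' \<alpha>" and lam = lam])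
    fix \<beta> u assume \<beta>: "set_mset \<beta> \<subseteq> {1..m}" "Suc (size \<beta>) = DIM('v)"
    then have "moment x \<beta> = 0" if "x \<in> generic" for x
      by (intro moment_lower that) auto
    then show "(\<Sum>j\<in>{1..m}. inner u (lam j) *
        (moment v (add_mset j \<beta>) - moment v' (add_mset j \<beta>))) = 0"
      using assms(1,2) localized_linear_relation[of u _ "\<lambda>_. 0" \<beta> 0]
      by (simp add: right_diff_distrib sum_subtractf)
  next
    fix I assume "I \<subseteq> {1..m}" "card I = DIM('v)"
    then show "moment v (mset_set I) - moment v' (mset_set I) = 0"
      by (simp add: moment_face assms(1,2))
  next
    fix \<beta> assume "\<not> indep_family lam (set_mset \<beta>)"
    then show "moment v \<beta> - moment v' \<beta> = 0"
      by (simp add: localized_dependent)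
  qed (use 0 in simp_all)
  then show ?case
    using localized_0[of v c \<alpha>] localized_0[of v' c \<alpha>] by simp
next
  case (Suc k)
  then show ?case
    unfolding localized_Suc by (intro sum.cong refl) simp
qed

text \<open>The integrand has the same value at all generic vectors, and \<open>v\<close> witnesses
  that there is one, so the description in \<open>multifan_integral\<close> denotes this
  value.\<close>

lemma volume_polynomial_eq:
  assumes "v \<in> generic"
  shows "volume_polynomial e m w lam c = localized v c {#} DIM('v) / fact DIM('v)"
proof -
  have integrand: "multifan_integrand e m w lam ((\<Sum>i\<in>{1..m}. c i *\<^sub>R poly_var i) ^ DIM('v)) x =
      localized x c {#} DIM('v)" for x
    by (simp add: multifan_integrand_def faces_def localized_def weight_def iota_eq linear_form_eval)
  have "multifan_integral e m w lam ((\<Sum>i\<in>{1..m}. c i *\<^sub>R poly_var i) ^ DIM('v)) =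
      localized v c {#} DIM('v)"
    unfolding multifan_integral_def integrand
  proof (rule the_equality)
    show "\<forall>x\<in>generic. localized x c {#} DIM('v) = localized v c {#} DIM('v)"
      by (intro ballI localized_independent[OF _ assms]) simp_all
  next
    fix a assume "\<forall>x\<in>generic. localized x c {#} DIM('v) = a"
    then show "a = localized v c {#} DIM('v)"
      using assms by simp
  qed
  then show ?thesis
    by (simp add: volume_polynomial_def)
qed

text \<open>By the chain rule each face contributes \<open>k\<close> times its coordinate at
  \<open>i\<close>, which is absorbed into the monomial.\<close>

lemma localized_DERIV:
  assumes "i \<in> {1..m}"
  shows "((\<lambda>t. localized v (c(i := t)) \<alpha> k) has_field_derivative
    real k * localized v (c(i := t)) (add_mset i \<alpha>) (k - 1)) (at t)"
proof -
  have form: "(\<Sum>j\<in>{1..m}. (c(i := t)) j * coord J v j) =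
      t * coord J v i + (\<Sum>j\<in>{1..m} - {i}. c j * coord J v j)" for J t
    using assms by (subst sum.remove[of _ i]) auto
  show ?thesis
    unfolding localized_def form sum_distrib_left
  proof (rule DERIV_sum)
    fix J
    let ?W = "weight J v * (\<Prod>j\<in>#\<alpha>. coord J v j)"
    let ?C = "\<Sum>j\<in>{1..m} - {i}. c j * coord J v j"
    have "((\<lambda>t. ?W * (t * coord J v i + ?C) ^ k) has_field_derivative
        ?W * (real k * (coord J v i * (t * coord J v i + ?C) ^ (k - 1)))) (at t)"
      by (auto intro!: derivative_eq_intros)
    then show "((\<lambda>t. ?W * (t * coord J v i + ?C) ^ k) has_field_derivative
        real k * (weight J v * (\<Prod>j\<in>#add_mset i \<alpha>. coord J v j) *
          (t * coord J v i + ?C) ^ (k - 1))) (at t)"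
      by (simp add: mult_ac)
  qed
qed

end


section \<open>Iterated derivatives\<close>

text \<open>Partial derivatives commute, so an iterated derivative depends only on the multiset of
  its indices. This is the same indexing as for the moments.\<close>

definition deriv_mset :: "nat multiset \<Rightarrow> rpoly \<Rightarrow> rpoly" where
  "deriv_mset \<alpha> p = fold_mset partial_deriv p \<alpha>"

interpretation partial_deriv: comp_fun_commute partial_deriv
  by unfold_locales (simp add: fun_eq_iff partial_deriv_commute)

lemma deriv_mset_empty [simp]: "deriv_mset {#} p = p"
  by (simp add: deriv_mset_def)

lemma deriv_mset_add_mset [simp]: "deriv_mset (add_mset i \<alpha>) p = partial_deriv i (deriv_mset \<alpha> p)"
  by (simp add: deriv_mset_def)

lemma deriv_mset_union: "deriv_mset (\<alpha> + \<beta>) p = deriv_mset \<alpha> (deriv_mset \<beta> p)"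
  by (induction \<alpha>) simp_all

lemma deriv_mset_zero [simp]: "deriv_mset \<alpha> 0 = 0"
  by (induction \<alpha>) simp_all

lemma partial_deriv_set_eq: "partial_deriv_set I p = deriv_mset (mset_set I) p"
proof -
  have "foldr partial_deriv xs p = deriv_mset (mset xs) p" for xs
    by (induction xs) simp_all
  moreover have "mset (sorted_list_of_set I) = mset_set I"
    by (metis mset_sorted_list_of_multiset sorted_list_of_mset_set)
  ultimately show ?thesis
    by (simp add: partial_deriv_set_def)
qed

lemma deriv_mset_homogeneous:
  "p \<in> homogeneous_polys m k \<Longrightarrow> deriv_mset \<alpha> p \<in> homogeneous_polys m (k - size \<alpha>)"
proof (induction \<alpha>)
  case (add i \<alpha>)
  then show ?case
    using partial_deriv_homogeneous[of "deriv_mset \<alpha> p" m "k - size \<alpha>" i] by simp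
qed simp

section \<open>Linear operators and the space \<open>Ann2\<close>\<close>

lemma linear_diff_op_homogeneous:
  "p \<in> homogeneous_polys m k \<Longrightarrow> linear_diff_op m a p \<in> homogeneous_polys m (k - 1)"
  unfolding linear_diff_op_def
  by (intro sum_homogeneous scaleR_homogeneous partial_deriv_homogeneous)

lemma partial_deriv_linear_diff_op:
  "partial_deriv i (linear_diff_op m a p) = linear_diff_op m a (partial_deriv i p)"
  unfolding linear_diff_op_def partial_deriv_sum partial_deriv_scaleR
  by (intro sum.cong refl) (simp add: partial_deriv_commute[of i])

lemma linear_diff_op_deriv_mset:
  "linear_diff_op m a (deriv_mset \<alpha> p) = deriv_mset \<alpha> (linear_diff_op m a p)"
  by (induction \<alpha>) (simp_all add: partial_deriv_linear_diff_op[symmetric])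

lemma poly_eval_linear_diff_op:
  "poly_eval c (linear_diff_op m a p) =
     (\<Sum>i\<in>{1..m}. Poly_Mapping.lookup a i * poly_eval c (partial_deriv i p))"
  by (simp add: linear_diff_op_def poly_eval_sum poly_eval_scaleR)

text \<open>An operator with constant coefficients commutes with all derivatives, so it annihilates
  every derivative of \<open>p\<close> as well.\<close>

lemma Ann2_deriv_mset:
  assumes "a \<in> Ann2 m p"
  shows "(\<Sum>i\<in>{1..m}. Poly_Mapping.lookup a i * poly_eval c (deriv_mset (add_mset i \<alpha>) p)) = 0"
proof -
  have "linear_diff_op m a (deriv_mset \<alpha> p) = 0"
    using assms by (simp add: linear_diff_op_deriv_mset Ann2_def)
  then show ?thesis
    using poly_eval_linear_diff_op[of c m a "deriv_mset \<alpha> p"] by simp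
qed

lemma subspace_Ann2: "subspace (Ann2 m p)"
  unfolding subspace_def
proof (intro conjI ballI allI)
  show "0 \<in> Ann2 m p"
    by (simp add: Ann2_def coeff_space_def linear_diff_op_def)
next
  fix a b assume "a \<in> Ann2 m p" "b \<in> Ann2 m p"
  then show "a + b \<in> Ann2 m p"
    using keys_add[of a b]
    by (auto simp: Ann2_def coeff_space_def linear_diff_op_def lookup_add scaleR_add_left sum.distrib)
next
  fix r a assume a: "a \<in> Ann2 m p"
  have "linear_diff_op m (r *\<^sub>R a) p = r *\<^sub>R linear_diff_op m a p"
    by (simp add: linear_diff_op_def scaleR_sum_right)
  then show "r *\<^sub>R a \<in> Ann2 m p"
    using a by (auto simp: Ann2_def coeff_space_def in_keys_iff)
qed

lemma lookup_coord_proj: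
  "finite I \<Longrightarrow> Poly_Mapping.lookup (coord_proj I a) k = (if k \<in> I then Poly_Mapping.lookup a k else 0)"
  by (simp add: coord_proj_def lookup_sum lookup_single when_def)

definition coeff_vec :: "nat \<Rightarrow> (nat \<Rightarrow> real) \<Rightarrow> nat \<Rightarrow>\<^sub>0 real" where
  "coeff_vec m f = (\<Sum>i\<in>{1..m}. Poly_Mapping.single i (f i))"

lemma lookup_coeff_vec:
  "Poly_Mapping.lookup (coeff_vec m f) k = (if k \<in> {1..m} then f k else 0)"
  by (simp add: coeff_vec_def lookup_sum lookup_single when_def)

lemma coeff_vec_in_coeff_space: "coeff_vec m f \<in> coeff_space {1..m}"
  by (auto simp: coeff_space_def in_keys_iff lookup_coeff_vec split: if_splits)

text \<open>Elements dual to the coordinates in \<open>J\<close> are linearly independent, as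
  reading off the coordinate at \<open>k\<close> from a relation gives its coefficient.\<close>

lemma card_le_dim:
  assumes "A \<subseteq> coeff_space {1..m}" "finite J"
    and dual: "\<And>i. i \<in> J \<Longrightarrow> \<exists>a\<in>A. \<forall>k\<in>J. Poly_Mapping.lookup a k = (if i = k then 1 else 0)"
  shows "card J \<le> dim A"
proof -
  have "\<forall>i. \<exists>a. i \<in> J \<longrightarrow> a \<in> A \<and> (\<forall>k\<in>J. Poly_Mapping.lookup a k = (if i = k then 1 else 0))"
    using dual by blast
  from choice[OF this] obtain a where a: "\<And>i. i \<in> J \<Longrightarrow> a i \<in> A"
    "\<And>i k. i \<in> J \<Longrightarrow> k \<in> J \<Longrightarrow> Poly_Mapping.lookup (a i) k = (if i = k then 1 else 0)"
    by auto
  have "indep_family a J"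
    unfolding indep_family_def
  proof (intro allI impI ballI)
    fix t k assume t: "(\<Sum>i\<in>J. t i *\<^sub>R a i) = 0" and k: "k \<in> J"
    have "0 = Poly_Mapping.lookup (\<Sum>i\<in>J. t i *\<^sub>R a i) k"
      by (simp add: t)
    also have "\<dots> = (\<Sum>i\<in>J. if i = k then t i else 0)"
      unfolding lookup_sum by (rule sum.cong) (simp_all add: a(2) k)
    also have "\<dots> = t k"
      using k assms(2) by simp
    finally show "t k = 0" by simp
  qed
  then have a_indep: "inj_on a J" "independent (a ` J)"
    using assms(2) by (simp_all add: indep_family_iff)
  obtain B where B: "B \<subseteq> A" "independent B" "A \<subseteq> span B" "card B = dim A"
    by (rule basis_exists[of A])
  \<comment> \<open>The ambient space of finitely supported vectors is infinite-dimensional; the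
    unit vectors in \<open>{1..m}\<close> ensure that the basis \<open>B\<close> is finite, so
    cardinalities can be compared.\<close>
  let ?S = "(\<lambda>i. Poly_Mapping.single i (1::real)) ` {1..m}"
  have "B \<subseteq> span ?S"
  proof
    fix b assume "b \<in> B"
    then have b: "b \<in> coeff_space {1..m}"
      using B(1) assms(1) by blast
    have "b = (\<Sum>i\<in>{1..m}. Poly_Mapping.lookup b i *\<^sub>R Poly_Mapping.single i 1)"
    proof (rule poly_mapping_eqI)
      fix k
      show "Poly_Mapping.lookup b k = Poly_Mapping.lookup
          (\<Sum>i\<in>{1..m}. Poly_Mapping.lookup b i *\<^sub>R Poly_Mapping.single i 1) k"
        using b by (auto simp: coeff_space_def lookup_sum lookup_single when_def in_keys_iff
            if_distrib[of "\<lambda>x. _ * x"] cong: if_cong)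
    qed
    moreover have "(\<Sum>i\<in>{1..m}. Poly_Mapping.lookup b i *\<^sub>R Poly_Mapping.single i (1::real)) \<in> span ?S"
      by (intro span_sum span_scale span_base imageI)
    ultimately show "b \<in> span ?S" by simp
  qed
  then have "finite B"
    using independent_span_bound[of ?S B] B(2) by simp
  moreover have "a ` J \<subseteq> span B"
    using a(1) B(3) by blast
  ultimately have "card (a ` J) \<le> card B"
    using independent_span_bound[of B "a ` J"] a_indep(2) by simp
  then show ?thesis
    using a_indep(1) B(4) by (simp add: card_image)
qed


section \<open>Volume polynomials satisfy the conditions\<close>

context multifan
begin

text \<open>The formal derivatives of \<Psi> and the derivatives of the localized sum are
  derivatives of the same function, hence equal. Each one brings down an exponent, which cancels a
  factor of the factorial.\<close>

lemma poly_eval_deriv_mset: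
  assumes vol: "\<And>c. poly_eval c \<Psi> = volume_polynomial e m w lam c"
    and "v \<in> generic" "set_mset \<alpha> \<subseteq> {1..m}" "size \<alpha> \<le> DIM('v)"
  shows "poly_eval c (deriv_mset \<alpha> \<Psi>) =
    localized v c \<alpha> (DIM('v) - size \<alpha>) / fact (DIM('v) - size \<alpha>)"
  using assms(3,4)
proof (induction \<alpha> arbitrary: c)
  case empty
  then show ?case
    by (simp add: vol volume_polynomial_eq[OF assms(2)])
next
  case (add i \<alpha>)
  define k where "k = DIM('v) - size (add_mset i \<alpha>)"
  have k: "DIM('v) - size \<alpha> = Suc k"
    using add.prems by (simp add: k_def)
  have i: "i \<in> {1..m}"
    using add.prems by simp
  have IH: "poly_eval c (deriv_mset \<alpha> \<Psi>) = localized v c \<alpha> (Suc k) / fact (Suc k)" for c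
    using add k by simp
  have "((\<lambda>t. poly_eval (c(i := t)) (deriv_mset \<alpha> \<Psi>)) has_field_derivative
      poly_eval (c(i := c i)) (partial_deriv i (deriv_mset \<alpha> \<Psi>))) (at (c i))"
    by (rule poly_eval_DERIV)
  moreover have "((\<lambda>t. localized v (c(i := t)) \<alpha> (Suc k) / fact (Suc k)) has_field_derivative
      (real (Suc k) * localized v (c(i := c i)) (add_mset i \<alpha>) (Suc k - 1)) / fact (Suc k)) (at (c i))"
    by (intro DERIV_cdivide localized_DERIV i)
  ultimately have "poly_eval c (deriv_mset (add_mset i \<alpha>) \<Psi>) =
      real (Suc k) * localized v c (add_mset i \<alpha>) k / fact (Suc k)"
    unfolding IH by (simp add: DERIV_unique)
  also have "\<dots> = localized v c (add_mset i \<alpha>) k / fact k"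
    by (simp add: fact_Suc del: of_nat_Suc)
  finally show ?case
    by (simp add: k_def)
qed

text \<open>Applied to \<Psi>, the operator yields \<open>inner u v\<close> times a localized sum of
  degree \<open>DIM('v) - 1\<close>, which is zero.\<close>

lemma linear_relation_in_Ann2:
  assumes "\<Psi> \<in> homogeneous_polys m DIM('v)"
    and vol: "\<And>c. poly_eval c \<Psi> = volume_polynomial e m w lam c"
  shows "coeff_vec m (\<lambda>i. inner u (lam i)) \<in> Ann2 m \<Psi>"
proof -
  obtain v where v: "v \<in> generic"
    using generic_nonempty by blast
  let ?a = "coeff_vec m (\<lambda>i. inner u (lam i))"
  have "poly_eval c (linear_diff_op m ?a \<Psi>) = 0" for c
  proof -
    have "poly_eval c (partial_deriv i \<Psi>) =
        localized v c {#i#} (DIM('v) - 1) / fact (DIM('v) - 1)" if "i \<in> {1..m}" for i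
      using poly_eval_deriv_mset[OF vol v, of "{#i#}" c] that by (simp add: Suc_leI)
    then have "poly_eval c (linear_diff_op m ?a \<Psi>) =
        (\<Sum>i\<in>{1..m}. inner u (lam i) * localized v c {#i#} (DIM('v) - 1)) / fact (DIM('v) - 1)"
      by (simp add: poly_eval_linear_diff_op lookup_coeff_vec sum_divide_distrib)
    also have "\<dots> = 0"
      using localized_linear_relation[of u v c "{#}"] localized_lower[OF v, of "{#}"] by simp
    finally show ?thesis .
  qed
  then have "linear_diff_op m ?a \<Psi> = 0"
    using homogeneous_eq_0 linear_diff_op_homogeneous[OF assms(1)] by blast
  then show ?thesis
    using coeff_vec_in_coeff_space by (simp add: Ann2_def)
qed

text \<open>If the vectors at \<open>I\<close> were independent, the operators coming from vectors
  \<open>u\<close> would already have arbitrary coefficients on \<open>I\<close>, contrary to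
  membership in \<open>dep\<close>. So they are dependent, and then no face contains
  \<open>I\<close>.\<close>

lemma partial_deriv_set_dep:
  assumes "\<Psi> \<in> homogeneous_polys m DIM('v)"
    and vol: "\<And>c. poly_eval c \<Psi> = volume_polynomial e m w lam c"
    and "I \<in> dep m DIM('v) (Ann2 m \<Psi>)"
  shows "partial_deriv_set I \<Psi> = 0"
proof -
  have I: "I \<subseteq> {1..m}" "card I \<le> DIM('v)" "coord_proj I ` Ann2 m \<Psi> \<noteq> coeff_space I"
    using assms(3) by (auto simp: dep_def)
  have fin: "finite I"
    using I(1) finite_subset by blast
  have indep: "\<not> indep_family lam I"
  proof
    assume indep: "indep_family lam I"
    have "\<forall>i. \<exists>u. \<forall>j\<in>I. inner u (lam j) = (if i = j then 1 else 0)"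
      using dual_vector_exists[OF indep fin] by simp
    from choice[OF this] obtain d
      where d: "\<And>i. \<forall>j\<in>I. inner (d i) (lam j) = (if i = j then 1 else 0)"
      by auto
    have "b \<in> coord_proj I ` Ann2 m \<Psi>" if b: "b \<in> coeff_space I" for b
    proof
      define u where "u = (\<Sum>i\<in>I. Poly_Mapping.lookup b i *\<^sub>R d i)"
      show "coeff_vec m (\<lambda>i. inner u (lam i)) \<in> Ann2 m \<Psi>"
        by (rule linear_relation_in_Ann2[OF assms(1) vol])
      have u: "inner u (lam k) = Poly_Mapping.lookup b k" if "k \<in> I" for k
      proof -
        have "inner u (lam k) = (\<Sum>i\<in>I. if i = k then Poly_Mapping.lookup b i else 0)"
          unfolding u_def inner_sum_left by (rule sum.cong) (use d that in simp_all)
        then show ?thesis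
          using that fin by simp
      qed
      show "b = coord_proj I (coeff_vec m (\<lambda>i. inner u (lam i)))"
      proof (rule poly_mapping_eqI)
        fix k
        show "Poly_Mapping.lookup b k =
            Poly_Mapping.lookup (coord_proj I (coeff_vec m (\<lambda>i. inner u (lam i)))) k"
        proof (cases "k \<in> I")
          case True
          then have "k \<in> {1..m}"
            using I(1) by blast
          then show ?thesis
            using True by (simp add: lookup_coord_proj[OF fin] lookup_coeff_vec u del: atLeastAtMost_iff)
        next
          case False
          then have "k \<notin> Poly_Mapping.keys b"
            using b by (auto simp: coeff_space_def)
          then show ?thesis
            using False by (simp add: lookup_coord_proj[OF fin] in_keys_iff)
        qed
      qed
    qed
    moreover have "coord_proj I a \<in> coeff_space I" for a
      by (auto simp: coeff_space_def in_keys_iff lookup_coord_proj[OF fin] split: if_splits)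
    ultimately show False
      using I(3) by blast
  qed
  obtain v where v: "v \<in> generic"
    using generic_nonempty by blast
  have "poly_eval c (deriv_mset (mset_set I) \<Psi>) = 0" for c
    using poly_eval_deriv_mset[OF vol v, of "mset_set I" c] I fin indep
    by (simp add: localized_dependent)
  then show ?thesis
    unfolding partial_deriv_set_eq
    using homogeneous_eq_0 deriv_mset_homogeneous[OF assms(1)] by blast
qed

text \<open>The dual basis of any face supplies \<open>DIM('v)\<close> independent operators.
  Without faces the volume polynomial is zero and every operator annihilates it.\<close>

lemma dim_Ann2:
  assumes "\<Psi> \<in> homogeneous_polys m DIM('v)"
    and vol: "\<And>c. poly_eval c \<Psi> = volume_polynomial e m w lam c"
    and "DIM('v) \<le> m \<or> \<Psi> \<noteq> 0"
  shows "DIM('v) \<le> dim (Ann2 m \<Psi>)"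
proof -
  have sub: "Ann2 m \<Psi> \<subseteq> coeff_space {1..m}"
    by (auto simp: Ann2_def)
  show ?thesis
  proof (cases "faces = {}")
    case True
    obtain v where v: "v \<in> generic"
      using generic_nonempty by blast
    have "poly_eval c \<Psi> = 0" for c
      using True by (simp add: vol volume_polynomial_eq[OF v] localized_def)
    then have "\<Psi> = 0"
      using homogeneous_eq_0 assms(1) by blast
    then have all: "Ann2 m \<Psi> = coeff_space {1..m}"
      by (auto simp: Ann2_def linear_diff_op_def)
    have "card {1..DIM('v)} \<le> dim (Ann2 m \<Psi>)"
    proof (rule card_le_dim[OF sub])
      fix i assume "i \<in> {1..DIM('v)}"
      \<comment> \<open>For \<open>\<Psi> = 0\<close> the assumption gives
        \<open>DIM('v) \<le> m\<close>, so these unit vectors have their index in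
        \<open>{1..m}\<close>.\<close>
      then have "Poly_Mapping.single i 1 \<in> Ann2 m \<Psi>"
        unfolding all using assms(3) \<open>\<Psi> = 0\<close> by (simp add: coeff_space_def)
      then show "\<exists>a\<in>Ann2 m \<Psi>. \<forall>k\<in>{1..DIM('v)}. Poly_Mapping.lookup a k = (if i = k then 1 else 0)"
        by (intro bexI[of _ "Poly_Mapping.single i 1"]) (auto simp: lookup_single when_def)
    qed simp
    then show ?thesis by simp
  next
    case False
    then obtain J where J: "J \<in> faces" by blast
    have "card J \<le> dim (Ann2 m \<Psi>)"
    proof (rule card_le_dim[OF sub facesD(1)[OF J]])
      fix i assume i: "i \<in> J"
      let ?a = "coeff_vec m (\<lambda>k. inner (dual_basis lam J i) (lam k))"
      have "Poly_Mapping.lookup ?a k = (if i = k then 1 else 0)" if "k \<in> J" for k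
      proof -
        have "k \<in> {1..m}"
          using facesD(2)[OF J] that by blast
        then show ?thesis
          using dual_basis_props(1)[OF facesD(5,1)[OF J] i that]
          by (simp add: lookup_coeff_vec del: atLeastAtMost_iff)
      qed
      then show "\<exists>a\<in>Ann2 m \<Psi>. \<forall>k\<in>J. Poly_Mapping.lookup a k = (if i = k then 1 else 0)"
        using linear_relation_in_Ann2[OF assms(1) vol] by blast
    qed
    then show ?thesis
      using facesD(3)[OF J] by simp
  qed
qed

end


section \<open>Generic operators\<close>

text \<open>
  Equivalently, the coordinate functions \<open>a \<mapsto> a\<^sub>i\<close>, \<open>i \<in> I\<close>, are linearly independent on the span of \<open>A\<close>.
\<close>

definition coords_independent :: "(nat \<Rightarrow>\<^sub>0 real) set \<Rightarrow> nat set \<Rightarrow> bool" where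
  "coords_independent A I \<longleftrightarrow>
     (\<forall>t. (\<forall>a\<in>A. (\<Sum>i\<in>I. t i * Poly_Mapping.lookup a i) = 0) \<longrightarrow> (\<forall>i\<in>I. t i = 0))"

lemma coords_independentD:
  assumes "coords_independent A I" "\<And>a. a \<in> A \<Longrightarrow> (\<Sum>i\<in>I. t i * Poly_Mapping.lookup a i) = 0" "i \<in> I"
  shows "t i = 0"
  using assms(1)[unfolded coords_independent_def, THEN spec[of _ t]] assms(2,3) by blast

lemma coords_independent_mono: "coords_independent A I \<Longrightarrow> A \<subseteq> B \<Longrightarrow> coords_independent B I"
  unfolding coords_independent_def[of B]
  by (intro allI impI ballI) (rule coords_independentD[of A I], auto)

lemma coords_independent_subset:
  assumes "coords_independent A I" "J \<subseteq> I" "finite I"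
  shows "coords_independent A J"
  unfolding coords_independent_def
proof (intro allI impI ballI)
  fix t i assume t: "\<forall>a\<in>A. (\<Sum>i\<in>J. t i * Poly_Mapping.lookup a i) = 0" and i: "i \<in> J"
  let ?t = "\<lambda>i. if i \<in> J then t i else 0"
  have "?t i = 0"
  proof (rule coords_independentD[OF assms(1)])
    fix a assume "a \<in> A"
    have "(\<Sum>i\<in>I. ?t i * Poly_Mapping.lookup a i) = (\<Sum>i\<in>J. t i * Poly_Mapping.lookup a i)"
      by (rule sum.mono_neutral_cong_right) (use assms(2,3) in auto)
    then show "(\<Sum>i\<in>I. ?t i * Poly_Mapping.lookup a i) = 0"
      using t \<open>a \<in> A\<close> by simp
  qed (use i assms(2) in blast)
  then show "t i = 0"
    using i by simp
qed

text \<open>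
  If the coordinates in \<open>I\<close> with one index removed are independent on \<open>B\<close>, the relations on \<open>B\<close> between
  the coordinates in \<open>I\<close> are the multiples of a single relation \<open>t\<close>, which \<open>x\<close> destroys.
\<close>

lemma coords_independent_insert:
  assumes "finite I" "\<And>i. i \<in> I \<Longrightarrow> coords_independent B (I - {i})"
    and t: "\<And>b. b \<in> B \<Longrightarrow> (\<Sum>i\<in>I. t i * Poly_Mapping.lookup b i) = 0" "j \<in> I" "t j \<noteq> 0"
    and x: "(\<Sum>i\<in>I. t i * Poly_Mapping.lookup x i) \<noteq> 0"
  shows "coords_independent (insert x B) I"
  unfolding coords_independent_def
proof (intro allI impI ballI)
  fix s i
  assume s: "\<forall>a\<in>insert x B. (\<Sum>i\<in>I. s i * Poly_Mapping.lookup a i) = 0" and i: "i \<in> I"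
  define r where "r i = t j * s i - s j * t i" for i
  have sum_r: "(\<Sum>i\<in>I. r i * Poly_Mapping.lookup a i) =
      t j * (\<Sum>i\<in>I. s i * Poly_Mapping.lookup a i) - s j * (\<Sum>i\<in>I. t i * Poly_Mapping.lookup a i)" for a
    by (simp add: r_def sum_distrib_left left_diff_distrib sum_subtractf mult.assoc)
  have r: "r i = 0" if "i \<in> I" for i
  proof (cases "i = j")
    case False
    show ?thesis
    proof (rule coords_independentD[OF assms(2)[OF t(2)]])
      fix b assume b: "b \<in> B"
      have "(\<Sum>i\<in>I. r i * Poly_Mapping.lookup b i) = 0"
        unfolding sum_r using s t(1) b by simp
      moreover have "r j = 0"
        by (simp add: r_def)
      ultimately show "(\<Sum>i\<in>I - {j}. r i * Poly_Mapping.lookup b i) = 0"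
        using assms(1) t(2) by (simp add: sum.remove)
    qed (use that False in simp)
  qed (simp add: r_def)
  have "(\<Sum>i\<in>I. r i * Poly_Mapping.lookup x i) = 0"
    using r by simp
  then have "s j * (\<Sum>i\<in>I. t i * Poly_Mapping.lookup x i) = 0"
    unfolding sum_r using s by simp
  then have "s j = 0"
    using x by simp
  then show "s i = 0"
    using r[OF i] t(3) by (simp add: r_def)
qed

text \<open>Operators are added one at a time. If the coordinates in \<open>I\<close> are
  independent on \<open>A\<close> but not on the operators chosen so far, some relation between them
  holds on the latter and fails on \<open>A\<close>. A new operator off finitely many hyperplanes
  breaks all these relations at once.\<close>

lemma generic_operators:
  assumes "subspace A"
  shows "\<exists>b :: nat \<Rightarrow> nat \<Rightarrow>\<^sub>0 real. (\<forall>j<k. b j \<in> A) \<and>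
    (\<forall>I. I \<subseteq> {1..m} \<longrightarrow> card I \<le> k \<longrightarrow> coords_independent A I \<longrightarrow> coords_independent (b ` {..<k}) I)"
proof (induction k)
  case 0
  have "coords_independent B I" if "I \<subseteq> {1..m}" "card I \<le> 0" for I B
  proof -
    have "I = {}"
      using that finite_subset[OF that(1)] by simp
    then show ?thesis
      by (simp add: coords_independent_def)
  qed
  then show ?case by simp
next
  case (Suc k)
  then obtain b where "(\<forall>j<k. b j \<in> A) \<and> (\<forall>I. I \<subseteq> {1..m} \<longrightarrow> card I \<le> k \<longrightarrow>
      coords_independent A I \<longrightarrow> coords_independent (b ` {..<k}) I)" ..
  then have b: "\<And>j. j < k \<Longrightarrow> b j \<in> A"
    "\<And>I. I \<subseteq> {1..m} \<Longrightarrow> card I \<le> k \<Longrightarrow> coords_independent A I \<Longrightarrow> coords_independent (b ` {..<k}) I"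
    by simp_all
  let ?B = "b ` {..<k}"
  \<comment> \<open>The sets that the new operator has to repair; smaller sets are settled by the
    induction hypothesis.\<close>
  define Q where "Q = {I. I \<subseteq> {1..m} \<and> card I = Suc k \<and> coords_independent A I \<and> \<not> coords_independent ?B I}"
  have "\<forall>I. \<exists>t. I \<in> Q \<longrightarrow> (\<forall>a\<in>?B. (\<Sum>i\<in>I. t i * Poly_Mapping.lookup a i) = 0) \<and> (\<exists>i\<in>I. t i \<noteq> 0)"
  proof
    fix I
    show "\<exists>t. I \<in> Q \<longrightarrow> (\<forall>a\<in>?B. (\<Sum>i\<in>I. t i * Poly_Mapping.lookup a i) = 0) \<and> (\<exists>i\<in>I. t i \<noteq> 0)"
    proof (cases "I \<in> Q")
      case True
      then have "\<not> coords_independent ?B I"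
        by (simp add: Q_def)
      then obtain t where "\<forall>a\<in>?B. (\<Sum>i\<in>I. t i * Poly_Mapping.lookup a i) = 0" "\<not> (\<forall>i\<in>I. t i = 0)"
        unfolding coords_independent_def by blast
      then show ?thesis
        by (intro exI[of _ t]) simp
    qed simp
  qed
  from choice[OF this] obtain t where tQ:
    "\<forall>I. I \<in> Q \<longrightarrow> (\<forall>a\<in>?B. (\<Sum>i\<in>I. t I i * Poly_Mapping.lookup a i) = 0) \<and> (\<exists>i\<in>I. t I i \<noteq> 0)" ..
  have t: "(\<Sum>i\<in>I. t I i * Poly_Mapping.lookup a i) = 0" if "I \<in> Q" "a \<in> ?B" for I a
    using tQ that by blast
  have t_nonzero: "\<exists>i\<in>I. t I i \<noteq> 0" if "I \<in> Q" for I
    using tQ that by blast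
  let ?F = "(\<lambda>I a. \<Sum>i\<in>I. t I i * Poly_Mapping.lookup a i) ` Q"
  have "\<exists>x\<in>A. \<forall>f\<in>?F. f x \<noteq> 0"
  proof (rule common_nonvanishing[OF _ assms])
    have "Q \<subseteq> Pow {1..m}"
      by (auto simp: Q_def)
    then have "finite Q"
      by (rule finite_subset) (intro finite_Pow_iff[THEN iffD2] finite_atLeastAtMost)
    then show "finite ?F"
      by (rule finite_imageI)
  next
    fix f assume "f \<in> ?F"
    then obtain I where f: "f = (\<lambda>a. \<Sum>i\<in>I. t I i * Poly_Mapping.lookup a i)"
      by blast
    show "linear f"
      unfolding f by (rule linearI)
        (simp_all add: lookup_add distrib_left sum.distrib sum_distrib_left mult_ac)
  next
    fix f assume "f \<in> ?F"
    then obtain I where f: "I \<in> Q" "f = (\<lambda>a. \<Sum>i\<in>I. t I i * Poly_Mapping.lookup a i)"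
      by blast
    show "\<exists>x\<in>A. f x \<noteq> 0"
    proof (rule ccontr)
      assume "\<not> (\<exists>x\<in>A. f x \<noteq> 0)"
      then have zero: "(\<Sum>i\<in>I. t I i * Poly_Mapping.lookup a i) = 0" if "a \<in> A" for a
        using that f(2) by simp
      have "coords_independent A I"
        using f(1) by (simp add: Q_def)
      from coords_independentD[OF this zero] show False
        using t_nonzero[OF f(1)] by blast
    qed
  qed
  then obtain x where x: "x \<in> A" "\<And>I. I \<in> Q \<Longrightarrow> (\<Sum>i\<in>I. t I i * Poly_Mapping.lookup x i) \<noteq> 0"
    by auto
  define b' where "b' = b(k := x)"
  have image: "b' ` {..<Suc k} = insert x ?B"
    unfolding b'_def lessThan_Suc by auto
  have "coords_independent (b' ` {..<Suc k}) I"
    if I: "I \<subseteq> {1..m}" "card I \<le> Suc k" "coords_independent A I" for I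
  proof (cases "coords_independent ?B I")
    case True
    then show ?thesis
      unfolding image by (rule coords_independent_mono) blast
  next
    case False
    then have Q: "I \<in> Q"
      using I b(2)[of I] by (cases "card I \<le> k") (auto simp: Q_def)
    have fin: "finite I"
      using I(1) finite_subset by blast
    obtain j where j: "j \<in> I" "t I j \<noteq> 0"
      using t_nonzero[OF Q] by blast
    show ?thesis
      unfolding image
    proof (rule coords_independent_insert[OF fin _ t[OF Q] j x(2)[OF Q]])
      fix i assume i: "i \<in> I"
      show "coords_independent ?B (I - {i})"
      proof (rule b(2))
        show "card (I - {i}) \<le> k"
          using i I(2) fin by simp
        show "coords_independent A (I - {i})"
          by (rule coords_independent_subset[OF I(3) _ fin]) blast
      qed (use I(1) in blast)
    qed
  qed
  moreover have "b' j \<in> A" if "j < Suc k" for j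
    using that b(1) x(1) by (cases "j = k") (simp_all add: b'_def)
  ultimately show ?case
    by (intro exI[of _ b']) simp
qed


section \<open>Realization by a multi-fan\<close>

text \<open>The chosen operators are the rows of a matrix and the vectors \<open>lam i\<close> its
  columns in the frame \<open>e\<close>. Independence of coordinates on the rows is thus
  independence of columns.\<close>

lemma generic_vector_configuration:
  fixes e :: "'v::euclidean_space list"
  assumes frame: "orthonormal_frame e"
    and A: "subspace A" "A \<subseteq> coeff_space {1..m}"
  obtains lam :: "nat \<Rightarrow> 'v" where
    "\<And>u. coeff_vec m (\<lambda>i. inner u (lam i)) \<in> A"
    "\<And>I. I \<subseteq> {1..m} \<Longrightarrow> card I \<le> DIM('v) \<Longrightarrow> \<not> indep_family lam I \<Longrightarrow> I \<in> dep m DIM('v) A"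
proof -
  let ?n = "DIM('v)"
  obtain b where b: "\<And>j. j < ?n \<Longrightarrow> b j \<in> A"
    "\<And>I. I \<subseteq> {1..m} \<Longrightarrow> card I \<le> ?n \<Longrightarrow> coords_independent A I \<Longrightarrow> coords_independent (b ` {..<?n}) I"
    using generic_operators[OF A(1), of ?n m] by auto
  define lam where "lam i = (\<Sum>j<?n. Poly_Mapping.lookup (b j) i *\<^sub>R e ! j)" for i
  have inner_e: "inner (e ! k) (lam i) = Poly_Mapping.lookup (b k) i" if "k < ?n" for k i
  proof -
    have "inner (e ! k) (lam i) = (\<Sum>j<?n. if j = k then Poly_Mapping.lookup (b j) i else 0)"
      unfolding lam_def inner_sum_right
      by (rule sum.cong) (use frame that in \<open>simp_all add: orthonormal_frame_def\<close>)
    then show ?thesis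
      using that by simp
  qed
  show thesis
  proof
    fix u
    have "coeff_vec m (\<lambda>i. inner u (lam i)) = (\<Sum>j<?n. inner u (e ! j) *\<^sub>R b j)"
    proof (rule poly_mapping_eqI)
      fix k
      show "Poly_Mapping.lookup (coeff_vec m (\<lambda>i. inner u (lam i))) k =
          Poly_Mapping.lookup (\<Sum>j<?n. inner u (e ! j) *\<^sub>R b j) k"
      proof (cases "k \<in> {1..m}")
        case True
        then show ?thesis
          by (simp add: lookup_coeff_vec lookup_sum lam_def inner_sum_right mult.commute)
      next
        case False
        have "Poly_Mapping.lookup (b j) k = 0" if "j < ?n" for j
        proof -
          have "Poly_Mapping.keys (b j) \<subseteq> {1..m}"
            using b(1)[OF that] A(2) unfolding coeff_space_def by blast
          then show ?thesis
            using False unfolding in_keys_iff[symmetric] subset_iff by (metis in_keys_iff)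
        qed
        then show ?thesis
          using False by (simp add: lookup_coeff_vec lookup_sum del: atLeastAtMost_iff)
      qed
    qed
    also have "\<dots> \<in> A"
      by (intro subspace_sum[OF A(1)] subspace_scale[OF A(1)] b(1)) simp
    finally show "coeff_vec m (\<lambda>i. inner u (lam i)) \<in> A" .
  next
    fix I assume I: "I \<subseteq> {1..m}" "card I \<le> ?n" "\<not> indep_family lam I"
    have fin: "finite I"
      using I(1) finite_subset by blast
    have "coord_proj I ` A \<noteq> coeff_space I"
    proof
      assume surj: "coord_proj I ` A = coeff_space I"
      have "coords_independent A I"
        unfolding coords_independent_def
      proof (intro allI impI ballI)
        fix t i assume t: "\<forall>a\<in>A. (\<Sum>i\<in>I. t i * Poly_Mapping.lookup a i) = 0" and i: "i \<in> I"
        \<comment> \<open>An element of \<open>A\<close> projecting to a unit vector isolates one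
          coefficient of a relation between coordinates.\<close>
        have "Poly_Mapping.single i 1 \<in> coord_proj I ` A"
          unfolding surj using i by (simp add: coeff_space_def)
        then obtain a where a: "a \<in> A" "Poly_Mapping.single i 1 = coord_proj I a"
          by blast
        have "Poly_Mapping.lookup a k = (if k = i then 1 else 0)" if "k \<in> I" for k
          using lookup_coord_proj[OF fin, of a k] that unfolding a(2)[symmetric]
          by (auto simp: lookup_single when_def split: if_splits)
        then have "(\<Sum>k\<in>I. t k * Poly_Mapping.lookup a k) = (\<Sum>k\<in>I. if k = i then t k else 0)"
          by (intro sum.cong) simp_all
        then show "t i = 0"
          using t a(1) fin i by simp
      qed
      then have ind: "coords_independent (b ` {..<?n}) I"
        by (rule b(2)[OF I(1,2)])
      have "indep_family lam I"
        unfolding indep_family_def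
      proof (intro allI impI ballI)
        fix t i assume t: "(\<Sum>i\<in>I. t i *\<^sub>R lam i) = 0" and i: "i \<in> I"
        show "t i = 0"
        proof (rule coords_independentD[OF ind _ i])
          fix a assume "a \<in> b ` {..<?n}"
          then obtain k where k: "k < ?n" "a = b k" by auto
          have "(\<Sum>i\<in>I. t i * Poly_Mapping.lookup a i) = inner (e ! k) (\<Sum>i\<in>I. t i *\<^sub>R lam i)"
            by (simp add: k inner_sum_right inner_e)
          then show "(\<Sum>i\<in>I. t i * Poly_Mapping.lookup a i) = 0"
            by (simp add: t)
        qed
      qed
      then show False
        using I(3) by simp
    qed
    then show "I \<in> dep m ?n A"
      using I(1,2) by (simp add: dep_def)
  qed
qed

lemma poly_eval_degree_0:
  assumes "p \<in> homogeneous_polys m 0"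
  shows "poly_eval c p = poly_eval (\<lambda>_. 0) p"
proof -
  have "\<alpha> = 0" if "\<alpha> \<in> Poly_Mapping.keys p" for \<alpha>
  proof (rule poly_mapping_eqI)
    fix i
    have "(\<Sum>i\<in>Poly_Mapping.keys \<alpha>. Poly_Mapping.lookup \<alpha> i) = 0"
      using assms that by (simp add: homogeneous_polys_def)
    then show "Poly_Mapping.lookup \<alpha> i = Poly_Mapping.lookup 0 i"
      by (cases "i \<in> Poly_Mapping.keys \<alpha>") (simp_all add: in_keys_iff)
  qed
  then show ?thesis
    unfolding poly_eval_def by (intro sum.cong refl arg_cong2[where f = "(*)"]) (metis keys_zero prod.empty)
qed

lemma realization:
  fixes e :: "'v::euclidean_space list" and lam :: "nat \<Rightarrow> 'v"
  assumes frame: "orthonormal_frame e"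
    and hom: "\<Psi> \<in> homogeneous_polys m DIM('v)"
    and rel: "\<And>u. coeff_vec m (\<lambda>i. inner u (lam i)) \<in> Ann2 m \<Psi>"
    and dep: "\<And>I. I \<subseteq> {1..m} \<Longrightarrow> card I \<le> DIM('v) \<Longrightarrow> \<not> indep_family lam I \<Longrightarrow> partial_deriv_set I \<Psi> = 0"
  shows "\<exists>w. complete_multifan e m w lam \<and> (\<forall>c. poly_eval c \<Psi> = volume_polynomial e m w lam c)"
proof -
  let ?n = "DIM('v)"
  \<comment> \<open>For \<open>size \<alpha> = DIM('v)\<close> the derivative is a constant, so the
    point of evaluation is immaterial.\<close>
  define T where "T \<alpha> = poly_eval (\<lambda>_. 0) (deriv_mset \<alpha> \<Psi>)" for \<alpha>
  \<comment> \<open>The weight is dictated by \<open>moment_face\<close>: where the determinant is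
    nonzero, the moment of \<open>mset_set I\<close> becomes \<open>T (mset_set I)\<close>. A
    dependent set gets weight 0, as \<open>basis_on\<close> demands.\<close>
  define w where "w I = \<bar>face_det e lam I\<bar> * T (mset_set I)" for I
  have T_rel: "(\<Sum>i\<in>{1..m}. inner u (lam i) * T (add_mset i \<alpha>)) = 0" for u \<alpha>
  proof -
    have "(\<Sum>i\<in>{1..m}. inner u (lam i) * T (add_mset i \<alpha>)) =
        (\<Sum>i\<in>{1..m}. Poly_Mapping.lookup (coeff_vec m (\<lambda>i. inner u (lam i))) i *
          poly_eval (\<lambda>_. 0) (deriv_mset (add_mset i \<alpha>) \<Psi>))"
      unfolding T_def by (rule sum.cong) (simp_all add: lookup_coeff_vec)
    then show ?thesis
      using Ann2_deriv_mset[OF rel] by simp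
  qed
  have T_dep: "T \<alpha> = 0"
    if \<alpha>: "set_mset \<alpha> \<subseteq> {1..m}" "size \<alpha> \<le> ?n" "\<not> indep_family lam (set_mset \<alpha>)" for \<alpha>
  proof -
    let ?I = "set_mset \<alpha>"
    have "partial_deriv_set ?I \<Psi> = 0"
      using dep \<alpha> card_set_mset_le_size[of \<alpha>] by simp
    \<comment> \<open>Differentiating first once in every index of the support already gives zero;
      the remaining multiplicities are applied to zero.\<close>
    then have "deriv_mset ((\<alpha> - mset_set ?I) + mset_set ?I) \<Psi> = 0"
      unfolding deriv_mset_union by (simp add: partial_deriv_set_eq)
    moreover have "(\<alpha> - mset_set ?I) + mset_set ?I = \<alpha>"
      by (intro subset_mset.diff_add mset_set_set_mset_msubset)
    ultimately show ?thesis
      by (simp add: T_def)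
  qed
  have complete: "complete_multifan e m w lam"
    unfolding complete_multifan_def
  proof (intro conjI ballI impI)
    fix I assume I: "I \<in> nsets {1..m} ?n" "w I \<noteq> 0"
    then have "finite I" "card I = ?n" "face_det e lam I \<noteq> 0"
      by (auto simp: nsets_def w_def)
    then show "basis_on lam I"
      using face_det_eq_0_iff[OF frame] basis_on_iff by blast
  next
    fix J assume "J \<in> nsets {1..m} (?n - 1)"
    then have J: "J \<subseteq> {1..m}" "finite J" "card J = ?n - 1"
      by (auto simp: nsets_def)
    obtain y where y:
      "\<And>i. i \<notin> J \<Longrightarrow> face_det e lam (insert i J) = (-1) ^ card {j\<in>J. j < i} * inner y (lam i)"
      "\<And>i. i \<in> J \<Longrightarrow> inner y (lam i) = 0"
      by (rule facet_det_functional[OF J(2,3), where e = e and lam = lam]) (rule that, simp_all)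
    have summand: "(-1) ^ card {j\<in>J. j < i} * multifan_chain e w lam (insert i J) =
        inner y (lam i) * T (add_mset i (mset_set J))" if i: "i \<in> {1..m} - J" for i
    proof -
      let ?d = "face_det e lam (insert i J)"
      have d: "?d = (-1) ^ card {j\<in>J. j < i} * inner y (lam i)"
        using y(1)[of i] i by simp
      have "multifan_chain e w lam (insert i J) = (\<bar>?d\<bar> * sgn ?d) * T (add_mset i (mset_set J))"
        using i J(2) by (simp add: multifan_chain_def w_def)
      also have "\<bar>?d\<bar> * sgn ?d = ?d"
        by (simp add: abs_mult_sgn)
      finally show ?thesis
        unfolding d by simp
    qed
    have "chain_boundary m (multifan_chain e w lam) J =
        (\<Sum>i\<in>{1..m} - J. inner y (lam i) * T (add_mset i (mset_set J)))"
      unfolding chain_boundary_def by (rule sum.cong) (simp_all only: summand)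
    \<comment> \<open>The sum may be extended over \<open>J\<close> because \<open>y\<close> is
      orthogonal to the vectors there; this turns it into the relation of an annihilating
      operator.\<close>
    also have "\<dots> = (\<Sum>i\<in>{1..m}. inner y (lam i) * T (add_mset i (mset_set J)))"
      by (rule sum.mono_neutral_left) (use y(2) in auto)
    also have "\<dots> = 0"
      by (rule T_rel)
    finally show "chain_boundary m (multifan_chain e w lam) J = 0" .
  qed
  interpret multifan e m w lam
    by unfold_locales (rule frame, rule complete)
  obtain v where v: "v \<in> generic"
    using generic_nonempty by blast
  \<comment> \<open>Both functionals satisfy the same homogeneous relations, vanish on dependent
    supports and agree on squarefree monomials.\<close>
  have T_eq: "T \<alpha> = moment v \<alpha>" if \<alpha>: "set_mset \<alpha> \<subseteq> {1..m}" "size \<alpha> = ?n" for \<alpha>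
  proof -
    have "T \<alpha> - moment v \<alpha> = 0"
    proof (rule functional_eq_0[where T = "\<lambda>\<alpha>. T \<alpha> - moment v \<alpha>" and lam = lam, OF _ _ _ \<alpha>])
      fix I assume I: "I \<subseteq> {1..m}" "card I = ?n"
      then have fin: "finite I"
        using finite_subset by blast
      show "T (mset_set I) - moment v (mset_set I) = 0"
      proof (cases "face_det e lam I = 0")
        case True
        then have "\<not> indep_family lam I"
          using face_det_eq_0_iff[OF frame fin I(2)] by blast
        then show ?thesis
          using T_dep[of "mset_set I"] localized_dependent[of "mset_set I"] I fin by simp
      next
        case False
        then show ?thesis
          using moment_face[OF v I] by (simp add: w_def)
      qed
    next
      fix \<alpha> assume "set_mset \<alpha> \<subseteq> {1..m}" "size \<alpha> = ?n" "\<not> indep_family lam (set_mset \<alpha>)"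
      then show "T \<alpha> - moment v \<alpha> = 0"
        by (simp add: T_dep localized_dependent)
    next
      fix \<beta> u assume "set_mset \<beta> \<subseteq> {1..m}" "Suc (size \<beta>) = ?n"
      then have "moment v \<beta> = 0"
        using moment_lower[OF v, of \<beta>] by simp
      then show "(\<Sum>j\<in>{1..m}. inner u (lam j) * (T (add_mset j \<beta>) - moment v (add_mset j \<beta>))) = 0"
        using T_rel[of u \<beta>] localized_linear_relation[of u v "\<lambda>_. 0" \<beta> 0]
        by (simp add: right_diff_distrib sum_subtractf)
    qed
    then show ?thesis by simp
  qed
  have eval: "poly_eval c (deriv_mset \<alpha> \<Psi>) = localized v c \<alpha> k / fact k"
    if "set_mset \<alpha> \<subseteq> {1..m}" "size \<alpha> + k = ?n" for c \<alpha> k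
    using that
  proof (induction k arbitrary: \<alpha>)
    case 0
    then have "deriv_mset \<alpha> \<Psi> \<in> homogeneous_polys m 0"
      using deriv_mset_homogeneous[OF hom, of \<alpha>] by simp
    then have "poly_eval c (deriv_mset \<alpha> \<Psi>) = T \<alpha>"
      unfolding T_def by (rule poly_eval_degree_0)
    then show ?case
      using T_eq[of \<alpha>] 0 localized_0[of v c \<alpha>] by simp
  next
    case (Suc k)
    have "deriv_mset \<alpha> \<Psi> \<in> homogeneous_polys m (Suc k)"
      using deriv_mset_homogeneous[OF hom, of \<alpha>] Suc.prems(2)[symmetric] by simp
    \<comment> \<open>Euler's identity recovers a derivative of positive degree from those of the
      next order, matching the expansion in \<open>localized_Suc\<close>.\<close>
    then have "real (Suc k) * poly_eval c (deriv_mset \<alpha> \<Psi>) =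
        (\<Sum>i\<in>{1..m}. c i * poly_eval c (deriv_mset (add_mset i \<alpha>) \<Psi>))"
      by (simp only: euler_identity deriv_mset_add_mset)
    also have "\<dots> = (\<Sum>i\<in>{1..m}. c i * (localized v c (add_mset i \<alpha>) k / fact k))"
    proof (rule sum.cong)
      fix i assume "i \<in> {1..m}"
      then have "poly_eval c (deriv_mset (add_mset i \<alpha>) \<Psi>) = localized v c (add_mset i \<alpha>) k / fact k"
        using Suc.prems by (intro Suc.IH) simp_all
      then show "c i * poly_eval c (deriv_mset (add_mset i \<alpha>) \<Psi>) =
          c i * (localized v c (add_mset i \<alpha>) k / fact k)"
        by (simp only:)
    qed simp
    also have "\<dots> = localized v c \<alpha> (Suc k) / fact k"
      by (simp add: localized_Suc sum_divide_distrib)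
    finally have "poly_eval c (deriv_mset \<alpha> \<Psi>) = localized v c \<alpha> (Suc k) / fact k / real (Suc k)"
      by (simp add: eq_divide_eq mult_ac del: of_nat_Suc)
    then show ?case
      by (simp add: fact_Suc mult.commute del: of_nat_Suc)
  qed
  have "poly_eval c \<Psi> = volume_polynomial e m w lam c" for c
    using eval[of "{#}" ?n c] by (simp add: volume_polynomial_eq[OF v])
  with complete show ?thesis by blast
qed

theorem theorem10p6:
  fixes m n :: nat
    and \<Psi> :: rpoly
    and e :: "'v::euclidean_space list"
  assumes "DIM('v) = n"
    and "orthonormal_frame e"
    and "\<Psi> \<in> homogeneous_polys m n"
    and "n \<le> m \<or> \<Psi> \<noteq> 0"
  shows "(\<exists>(w :: nat set \<Rightarrow> real) (lam :: nat \<Rightarrow> 'v). complete_multifan e m w lam \<and>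
            (\<forall>c. poly_eval c \<Psi> = volume_polynomial e m w lam c))
     \<longleftrightarrow> dim (Ann2 m \<Psi>) \<ge> n \<and>
         (\<forall>I\<in>dep m n (Ann2 m \<Psi>). partial_deriv_set I \<Psi> = 0)"
proof
  assume "\<exists>(w :: nat set \<Rightarrow> real) (lam :: nat \<Rightarrow> 'v). complete_multifan e m w lam \<and>
    (\<forall>c. poly_eval c \<Psi> = volume_polynomial e m w lam c)"
  then obtain w and lam :: "nat \<Rightarrow> 'v" where
    fan: "complete_multifan e m w lam" and vol: "\<And>c. poly_eval c \<Psi> = volume_polynomial e m w lam c"
    by blast
  interpret multifan e m w lam
    by unfold_locales (rule assms(2), rule fan)
  have hom: "\<Psi> \<in> homogeneous_polys m DIM('v)" and nz: "DIM('v) \<le> m \<or> \<Psi> \<noteq> 0"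
    using assms by simp_all
  show "dim (Ann2 m \<Psi>) \<ge> n \<and> (\<forall>I\<in>dep m n (Ann2 m \<Psi>). partial_deriv_set I \<Psi> = 0)"
    unfolding assms(1)[symmetric]
    by (intro conjI ballI dim_Ann2[OF hom vol nz] partial_deriv_set_dep[OF hom vol])
next
  assume *: "dim (Ann2 m \<Psi>) \<ge> n \<and> (\<forall>I\<in>dep m n (Ann2 m \<Psi>). partial_deriv_set I \<Psi> = 0)"
  have hom: "\<Psi> \<in> homogeneous_polys m DIM('v)"
    using assms by simp
  have sub: "Ann2 m \<Psi> \<subseteq> coeff_space {1..m}"
    by (auto simp: Ann2_def)
  obtain lam :: "nat \<Rightarrow> 'v" where lam:
    "\<And>u. coeff_vec m (\<lambda>i. inner u (lam i)) \<in> Ann2 m \<Psi>"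
    "\<And>I. I \<subseteq> {1..m} \<Longrightarrow> card I \<le> DIM('v) \<Longrightarrow> \<not> indep_family lam I \<Longrightarrow>
      I \<in> dep m DIM('v) (Ann2 m \<Psi>)"
    by (rule generic_vector_configuration[OF assms(2) subspace_Ann2 sub]) (rule that, simp_all)
  have "\<exists>w. complete_multifan e m w lam \<and> (\<forall>c. poly_eval c \<Psi> = volume_polynomial e m w lam c)"
  proof (rule realization[OF assms(2) hom lam(1)])
    fix I assume "I \<subseteq> {1..m}" "card I \<le> DIM('v)" "\<not> indep_family lam I"
    \<comment> \<open>A dependent set of at most \<open>DIM('v)\<close> vertices lies in
      \<open>dep\<close>, so condition (2) applies to it.\<close>
    then show "partial_deriv_set I \<Psi> = 0"
      using lam(2)[of I] * assms(1) by blast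
  qed
  then show "\<exists>(w :: nat set \<Rightarrow> real) (lam :: nat \<Rightarrow> 'v). complete_multifan e m w lam \<and>
    (\<forall>c. poly_eval c \<Psi> = volume_polynomial e m w lam c)"
    by blast
qed

end
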